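(* Let $\Omega$ be a locally compact Hausdorff space, $\alpha:\Omega\to\Omega$ an aperiodic homeomorphism, and $w:\Omega\to(0,\infty)$ a bounded positive function with $w^{-1}=1/w\in C_b(\Omega)$. Suppose that for every compact subset $K$ of $\Omega$ and any two measures $\mu,v\in M(\Omega)$ with $|\mu|(K^{c})=|v|(K^{c})=0$ there exist a strictly increasing sequence $\{n_k\}_k\subseteq\mathbb{N}$ and sequences $\{A_k\}_k,\{F_k\}_k,\{D_k\}_k$ of Borel subsets of $K$ such that $$\lim_{k\to\infty}|\mu|(A_k)=\lim_{k\to\infty}|v|(A_k)=0,$$ $$\lim_{k\to\infty}\ \sup_{t\in K\cap A_k^{c}}\Big(\prod_{j=0}^{n_k-1}(w\circ\alpha^{j})(t)\Big)=\lim_{k\to\infty}\ \sup_{t\in K\cap A_k^{c}}\Big(\prod_{j=0}^{n_k-1}(w\circ\alpha^{-j})^{-1}(t)\Big)=0,$$ $$\lim_{k\to\infty}\ \sup_{t\in F_k}\Big(\prod_{j=0}^{2n_k-1}(w\circ\alpha^{j})(t)\Big)=\lim_{k\to\infty}\ \sup_{t\in D_k}\Big(\prod_{j=1}^{2n_k}(w\circ\alpha^{-j})^{-1}(t)\Big)=0,$$ where $F_k\cap D_k=\varnothing$ and $A_k^{c}\cap K=F_k\cup D_k$ for all $k$. Then the sequence $(C_{\alpha,w}^{(n)^{*}})_n$ is topologically hyper-transitive on $M(\Omega)$.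
   Context: $\mathbb{N}=\{1,2,\dots\}$. For $n\in\mathbb{N}$, $\alpha^n$ is the $n$-fold composition of $\alpha$ with itself, $\alpha^0=\mathrm{id}$, $\alpha^{-n}=(\alpha^{-1})^n$. A homeomorphism $\alpha$ of $\Omega$ is aperiodic if for each compact $K\subseteq\Omega$ there is $N>0$ such that $K\cap\alpha^n(K)=\varnothing$ for all $n\ge N$. $C_0(\Omega)$ is the space of continuous complex functions on $\Omega$ vanishing at infinity and $C_b(\Omega)$ that of bounded continuous functions, both with the supremum norm. $(w\circ\alpha^{-j})^{-1}$ denotes the pointwise reciprocal $1/(w\circ\alpha^{-j})$. The weighted composition operator $T_{\alpha,w}$ on $C_0(\Omega)$ is $T_{\alpha,w}f=w\cdot(f\circ\alpha)$; it is bounded and invertible, with inverse $S_{\alpha,w}f=(f\circ\alpha^{-1})/(w\circ\alpha^{-1})$. $M(\Omega)$ is the Banach space of complex Radon measures on $\Omega$ with the total variation norm $\|\mu\|=|\mu|(\Omega)$, identified with the dual of $C_0(\Omega)$ via $\mu\mapsto(f\mapsto\int f\,d\mu)$; $T_{\alpha,w}^*$ and $S_{\alpha,w}^*$ are the adjoints of $T_{\alpha,w}$ and $S_{\alpha,w}$, acting on $M(\Omega)$; thus $T_{\alpha,w}^*(\mu)(E)=\int_E w\circ\alpha^{-1}\,d(\mu\circ\alpha^{-1})$ for Borel $E$, where $(\mu\circ\alpha^{-1})(E)=\mu(\alpha^{-1}(E))$, and $S_{\alpha,w}^*=(T_{\alpha,w}^* )^{-1}$. For $n\in\mathbb{N}$,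 $C_{\alpha,w}^{(n)^{*}}=\frac12\big(T_{\alpha,w}^{*n}+S_{\alpha,w}^{*n}\big)$. A sequence $(T_n)_n$ of bounded operators on a Banach space $\mathcal X$ is topologically hyper-transitive if for all non-empty open $U,V\subseteq\mathcal X$ there is a strictly increasing sequence $\{n_k\}_k\subseteq\mathbb{N}$ with $T_{n_k}(U)\cap V\neq\varnothing$ for all $k\in\mathbb{N}$. Complements are taken in $\Omega$. The supremum of a nonnegative quantity over the empty set is taken to be $0$. *)

theory Defs
  imports "HOL-Analysis.Analysis"
begin

section \<open>Complex Radon measures\<close>

definition vector_measure ::
    "('a::topological_space set \<Rightarrow> 'b::real_normed_vector) \<Rightarrow> bool" where
  "vector_measure \<mu> \<longleftrightarrow>
     (\<forall>A::nat \<Rightarrow> 'a set. range A \<subseteq> sets borel \<longrightarrow> disjoint_family A \<longrightarrow>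
        (\<lambda>i. \<mu> (A i)) sums \<mu> (\<Union>i. A i))"

definition borel_partitions :: "'a::topological_space set \<Rightarrow> (nat \<Rightarrow> 'a set) set" where
  "borel_partitions E = {A. range A \<subseteq> sets borel \<and> disjoint_family A \<and> (\<Union>i. A i) = E}"

definition total_variation ::
    "('a::topological_space set \<Rightarrow> 'b::real_normed_vector) \<Rightarrow> 'a set \<Rightarrow> ennreal" where
  "total_variation \<mu> E = (SUP A\<in>borel_partitions E. \<Sum>i. ennreal (norm (\<mu> (A i))))"

definition regular_on_borel :: "('a::topological_space set \<Rightarrow> ennreal) \<Rightarrow> bool" where
  "regular_on_borel m \<longleftrightarrow> (\<forall>E\<in>sets borel.
     m E = (INF V\<in>{V. open V \<and> E \<subseteq> V}. m V) \<and>
     m E = (SUP K\<in>{K. compact K \<and> K \<subseteq> E}. m K))"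

text \<open>
  Values outside the Borel sets are normalised to zero, so that equality of set functions is
  equality of measures. Finiteness of the total variation is automatic for complex measures;
  it is included to have it at hand.
\<close>

definition complex_radon :: "('a::topological_space set \<Rightarrow> complex) \<Rightarrow> bool" where
  "complex_radon \<mu> \<longleftrightarrow>
     vector_measure \<mu> \<and> (\<forall>E. E \<notin> sets borel \<longrightarrow> \<mu> E = 0) \<and>
     total_variation \<mu> UNIV < \<infinity> \<and> regular_on_borel (total_variation \<mu>)"


subsection \<open>The total variation is a measure\<close>

lemma vector_measure_empty: "vector_measure \<mu> \<Longrightarrow> \<mu> {} = 0"
proof -
  assume "vector_measure \<mu>"
  then have "(\<lambda>i::nat. \<mu> {}) sums \<mu> (\<Union>i::nat. {})"
    unfolding vector_measure_def
    by (elim allE[of _ "\<lambda>i. {}"]) (simp add: disjoint_family_on_def)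
  then have "(\<lambda>i::nat. \<mu> {}) \<longlonglongrightarrow> 0" 
    using sums_summable summable_LIMSEQ_zero by blast
  then show ?thesis by (simp add: LIMSEQ_const_iff)
qed

lemma ennreal_norm_sums_le:
  fixes f :: "nat \<Rightarrow> 'b::real_normed_vector"
  assumes "f sums s"
  shows "ennreal (norm s) \<le> (\<Sum>i. ennreal (norm (f i)))"
proof -
  have "(\<lambda>n. ennreal (norm (\<Sum>i<n. f i))) \<longlonglongrightarrow> ennreal (norm s)"
    using assms by (intro tendsto_ennrealI tendsto_norm) (simp add: sums_def)
  moreover have "ennreal (norm (\<Sum>i<n. f i)) \<le> (\<Sum>i. ennreal (norm (f i)))" for n
  proof -
    have "ennreal (norm (\<Sum>i<n. f i)) \<le> ennreal (\<Sum>i<n. norm (f i))"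
      by (intro ennreal_leI norm_sum)
    also have "\<dots> = (\<Sum>i<n. ennreal (norm (f i)))" by (simp add: sum_ennreal)
    also have "\<dots> \<le> (\<Sum>i. ennreal (norm (f i)))" by (intro sum_le_suminf) auto
    finally show ?thesis .
  qed
  ultimately show ?thesis using LIMSEQ_le_const2 by blast
qed

lemma ennreal_suminf_swap:
  "(\<Sum>i. \<Sum>j. f i j) = (\<Sum>j. \<Sum>i. (f i j :: ennreal))"
  using nn_integral_suminf[of "\<lambda>i j. f i j" "count_space UNIV"]
  by (simp add: nn_integral_count_space_nat)

lemma borel_partitions_self: 
  assumes "E \<in> sets borel" 
  shows "(\<lambda>i. if i = 0 then E else {}) \<in> borel_partitions E"
  using assms by (auto simp: borel_partitions_def disjoint_family_on_def)

lemma borel_partitions_nonempty: "E \<in> sets borel \<Longrightarrow> borel_partitions E \<noteq> {}"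
  using borel_partitions_self by blast

lemma total_variation_upper:
  "A \<in> borel_partitions E \<Longrightarrow> (\<Sum>i. ennreal (norm (\<mu> (A i)))) \<le> total_variation \<mu> E"
  unfolding total_variation_def by (rule SUP_upper)

lemma total_variation_le_suminf:
  fixes E :: "nat \<Rightarrow> 'a::topological_space set"
  assumes \<mu>: "vector_measure \<mu>" and E: "range E \<subseteq> sets borel" "disjoint_family E"
  shows "total_variation \<mu> (\<Union>i. E i) \<le> (\<Sum>i. total_variation \<mu> (E i))"
  unfolding total_variation_def[of \<mu> "\<Union>i. E i"]
proof (rule SUP_least)
  fix A assume "A \<in> borel_partitions (\<Union>i. E i)"
  then have A: "range A \<subseteq> sets borel" "disjoint_family A" "(\<Union>j. A j) = (\<Union>i. E i)"
    by (auto simp: borel_partitions_def)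
  have "ennreal (norm (\<mu> (A j))) \<le> (\<Sum>i. ennreal (norm (\<mu> (A j \<inter> E i))))" for j
  proof (rule ennreal_norm_sums_le)
    have "range (\<lambda>i. A j \<inter> E i) \<subseteq> sets borel" "disjoint_family (\<lambda>i. A j \<inter> E i)"
      using A(1,2) E by (auto simp: disjoint_family_on_def) blast
    moreover have "(\<Union>i. A j \<inter> E i) = A j" using A(3) by blast
    ultimately show "(\<lambda>i. \<mu> (A j \<inter> E i)) sums \<mu> (A j)"
      using \<mu>[unfolded vector_measure_def, rule_format, of "\<lambda>i. A j \<inter> E i"] by simp
  qed
  then have "(\<Sum>j. ennreal (norm (\<mu> (A j)))) \<le> (\<Sum>j. \<Sum>i. ennreal (norm (\<mu> (A j \<inter> E i))))"
    by (rule suminf_le) (rule summableI)+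
  also have "\<dots> = (\<Sum>i. \<Sum>j. ennreal (norm (\<mu> (A j \<inter> E i))))"
    by (rule ennreal_suminf_swap)
  also have "\<dots> \<le> (\<Sum>i. total_variation \<mu> (E i))"
  proof (intro suminf_le)
    fix i
    have "(\<Union>j. A j \<inter> E i) = E i" using A(3) by blast
    moreover have "disjoint_family (\<lambda>j. A j \<inter> E i)"
      using A(2) by (fastforce simp: disjoint_family_on_def)
    ultimately have "(\<lambda>j. A j \<inter> E i) \<in> borel_partitions (E i)"
      using A(1) E(1) by (auto simp: borel_partitions_def)
    then show "(\<Sum>j. ennreal (norm (\<mu> (A j \<inter> E i)))) \<le> total_variation \<mu> (E i)"
      by (rule total_variation_upper)
  qed (rule summableI)+
  finally show "(\<Sum>j. ennreal (norm (\<mu> (A j)))) \<le> (\<Sum>i. total_variation \<mu> (E i))" .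
qed

lemma suminf_ennreal_interleave:
  fixes f g :: "nat \<Rightarrow> ennreal"
  shows "(\<Sum>i. f i) + (\<Sum>i. g i) \<le> (\<Sum>i. if even i then f (i div 2) else g (i div 2))"
    (is "_ \<le> suminf ?h")
proof (rule LIMSEQ_le_const2)
  show "(\<lambda>n. (\<Sum>i<n. f i) + (\<Sum>i<n. g i)) \<longlonglongrightarrow> (\<Sum>i. f i) + (\<Sum>i. g i)"
    by (intro tendsto_add summable_LIMSEQ) auto
  have "(\<Sum>i<n. f i) + (\<Sum>i<n. g i) = (\<Sum>i<2 * n. ?h i)" for n
    by (induction n) (auto simp: algebra_simps)
  then show "\<exists>N. \<forall>n\<ge>N. (\<Sum>i<n. f i) + (\<Sum>i<n. g i) \<le> suminf ?h"
    by (auto intro!: sum_le_suminf)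
qed

lemma total_variation_add_le:
  assumes AB: "A \<inter> B = {}" and A: "A \<in> sets borel" and B: "B \<in> sets borel"
  shows "total_variation \<mu> A + total_variation \<mu> B \<le> total_variation \<mu> (A \<union> B)"
proof -
  have *: "(\<Sum>i. ennreal (norm (\<mu> (P i)))) + (\<Sum>i. ennreal (norm (\<mu> (Q i)))) \<le> total_variation \<mu> (A \<union> B)"
    if P: "P \<in> borel_partitions A" and Q: "Q \<in> borel_partitions B" for P Q
  proof -
    let ?R = "\<lambda>i::nat. if even i then P (i div 2) else Q (i div 2)"
    have PQ: "P i \<in> sets borel" "Q i \<in> sets borel" "P i \<subseteq> A" "Q i \<subseteq> B" for i
      using P Q by (auto simp: borel_partitions_def)
    have "disjoint_family ?R"
      unfolding disjoint_family_on_def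
    proof (intro ballI impI)
      fix i j :: nat assume "i \<noteq> j"
      then have *: "even i = even j \<Longrightarrow> i div 2 \<noteq> j div 2" by presburger
      have PP: "P m \<inter> P n = {}" "Q m \<inter> Q n = {}" if "m \<noteq> n" for m n
        using P Q that by (auto simp: borel_partitions_def disjoint_family_on_def)
      have QP: "P m \<inter> Q n = {}" "Q m \<inter> P n = {}" for m n
        using PQ AB by blast+
      show "?R i \<inter> ?R j = {}"
        using * PP QP by auto
    qed
    moreover have "(\<Union>i. ?R i) = A \<union> B"
    proof
      show "(\<Union>i. ?R i) \<subseteq> A \<union> B" using PQ(3,4) by (force split: if_splits)
      have "P i \<subseteq> ?R (2 * i)" "Q i \<subseteq> ?R (Suc (2 * i))" for i by auto
      then have "(\<Union>i. P i) \<subseteq> (\<Union>i. ?R i)" "(\<Union>i. Q i) \<subseteq> (\<Union>i. ?R i)" by blast+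
      then show "A \<union> B \<subseteq> (\<Union>i. ?R i)"
        using P Q by (simp add: borel_partitions_def)
    qed
    ultimately have "?R \<in> borel_partitions (A \<union> B)"
      using PQ by (auto simp: borel_partitions_def)
    from total_variation_upper[OF this, of \<mu>]
    have "(\<Sum>i. ennreal (norm (\<mu> (?R i)))) \<le> total_variation \<mu> (A \<union> B)" .
    also have "(\<lambda>i. ennreal (norm (\<mu> (?R i)))) =
       (\<lambda>i. if even i then ennreal (norm (\<mu> (P (i div 2)))) else ennreal (norm (\<mu> (Q (i div 2)))))"
      by auto
    finally show ?thesis using suminf_ennreal_interleave by (rule order_trans[rotated])
  qed
  show ?thesis
    unfolding total_variation_def[of \<mu> A] total_variation_def[of \<mu> B]
      ennreal_SUP_add_left[OF borel_partitions_nonempty[OF A], symmetric]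
      ennreal_SUP_add_right[OF borel_partitions_nonempty[OF B]]
    using * by (intro SUP_least) auto
qed

lemma total_variation_mono:
  assumes "A \<subseteq> B" "A \<in> sets borel" "B \<in> sets borel"
  shows "total_variation \<mu> A \<le> total_variation \<mu> B"
proof -
  have "A \<union> (B - A) = B" using assms by blast
  then show ?thesis
    using total_variation_add_le[of A "B - A" \<mu>] assms
    by (metis Diff_disjoint add_increasing2 dual_order.trans order_refl sets.Diff zero_le le_iff_add)
qed

lemma total_variation_empty:
  assumes "vector_measure \<mu>" shows "total_variation \<mu> {} = 0"
proof -
  have "total_variation \<mu> {} \<le> 0"
    unfolding total_variation_def
  proof (rule SUP_least)
    fix A :: "nat \<Rightarrow> 'a set" assume "A \<in> borel_partitions {}"
    then have "A = (\<lambda>i. {})"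
      by (auto simp: borel_partitions_def fun_eq_iff)
    then show "(\<Sum>i. ennreal (norm (\<mu> (A i)))) \<le> 0"
      by (simp add: vector_measure_empty[OF assms])
  qed
  then show ?thesis by simp
qed

lemma total_variation_countably_additive:
  assumes \<mu>: "vector_measure \<mu>"
  shows "countably_additive (sets borel) (total_variation \<mu>)"
  unfolding countably_additive_def
proof (intro allI impI antisym)
  fix E :: "nat \<Rightarrow> 'a set"
  assume E: "range E \<subseteq> sets borel" "disjoint_family E" "\<Union> (range E) \<in> sets borel"
  have fin: "(\<Sum>i<n. total_variation \<mu> (E i)) \<le> total_variation \<mu> (\<Union>i<n. E i)" for n
  proof (induction n)
    case 0
    then show ?case by (simp add: total_variation_empty[OF \<mu>])
  next
    case (Suc n)
    have "E i \<inter> E n = {}" if "i < n" for i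
      using E(2) that by (simp add: disjoint_family_on_def)
    then have "(\<Union>i<n. E i) \<inter> E n = {}" by blast
    then have "total_variation \<mu> (\<Union>i<n. E i) + total_variation \<mu> (E n)
        \<le> total_variation \<mu> ((\<Union>i<n. E i) \<union> E n)"
      using E(1) by (intro total_variation_add_le) auto
    moreover have "(\<Union>i<n. E i) \<union> E n = (\<Union>i<Suc n. E i)"
      by (auto simp: less_Suc_eq)
    ultimately have "total_variation \<mu> (\<Union>i<n. E i) + total_variation \<mu> (E n)
        \<le> total_variation \<mu> (\<Union>i<Suc n. E i)" by metis
    then show ?case
      unfolding sum.lessThan_Suc by (rule order_trans[OF add_right_mono[OF Suc]])
  qed
  show "(\<Sum>i. total_variation \<mu> (E i)) \<le> total_variation \<mu> (\<Union> (range E))"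
  proof (rule suminf_le_const)
    fix n
    have "total_variation \<mu> (\<Union>i<n. E i) \<le> total_variation \<mu> (\<Union> (range E))"
      using E by (intro total_variation_mono) auto
    then show "(\<Sum>i<n. total_variation \<mu> (E i)) \<le> total_variation \<mu> (\<Union> (range E))"
      using fin[of n] by (rule order_trans[rotated])
  qed (rule summableI)
  show "total_variation \<mu> (\<Union> (range E)) \<le> (\<Sum>i. total_variation \<mu> (E i))"
    using total_variation_le_suminf[OF \<mu> E(1,2)] .
qed

definition variation_measure ::
    "('a::topological_space set \<Rightarrow> 'b::real_normed_vector) \<Rightarrow> 'a measure" where
  "variation_measure \<mu> = measure_of UNIV (sets borel) (total_variation \<mu>)"

lemma space_variation_measure [simp]: "space (variation_measure \<mu>) = UNIV"
  by (simp add: variation_measure_def space_measure_of_conv)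

lemma sets_variation_measure [simp, measurable_cong]: "sets (variation_measure \<mu>) = sets borel"
  using sets.sigma_sets_eq[of borel]
  by (simp add: variation_measure_def sets_measure_of_conv)

lemma emeasure_variation_measure:
  fixes \<mu> :: "'a::topological_space set \<Rightarrow> 'b::real_normed_vector"
  assumes \<mu>: "vector_measure \<mu>" and "E \<in> sets borel"
  shows "emeasure (variation_measure \<mu>) E = total_variation \<mu> E"
  unfolding variation_measure_def
proof (rule emeasure_measure_of_sigma)
  show "sigma_algebra UNIV (sets (borel :: 'a measure))"
    using sets.sigma_algebra_axioms[of "borel :: 'a measure"] by simp
  show "positive (sets borel) (total_variation \<mu>)"
    by (simp add: positive_def total_variation_empty[OF \<mu>])
qed (use assms total_variation_countably_additive in auto)

lemma norm_le_total_variation: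
  assumes "vector_measure \<mu>" "E \<in> sets borel"
  shows "ennreal (norm (\<mu> E)) \<le> total_variation \<mu> E"
proof -
  let ?A = "\<lambda>i::nat. if i = 0 then E else {}"
  have "(\<Sum>i\<in>{0}. ennreal (norm (\<mu> (?A i)))) \<le> (\<Sum>i. ennreal (norm (\<mu> (?A i))))"
    by (rule sum_le_suminf) auto
  also have "\<dots> \<le> total_variation \<mu> E"
    by (rule total_variation_upper[OF borel_partitions_self[OF assms(2)]])
  finally show ?thesis by simp
qed

lemma total_variation_add:
  fixes \<mu> \<nu> :: "'a::topological_space set \<Rightarrow> 'b::real_normed_vector"
  shows "total_variation (\<lambda>E. \<mu> E + \<nu> E) E \<le> total_variation \<mu> E + total_variation \<nu> E"
  unfolding total_variation_def[of "\<lambda>E. \<mu> E + \<nu> E"]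
proof (rule SUP_least)
  fix A :: "nat \<Rightarrow> 'a set" assume A: "A \<in> borel_partitions E"
  have "(\<Sum>i. ennreal (norm (\<mu> (A i) + \<nu> (A i))))
      \<le> (\<Sum>i. ennreal (norm (\<mu> (A i))) + ennreal (norm (\<nu> (A i))))"
    by (intro suminf_le)
      (auto simp: ennreal_plus[symmetric] norm_triangle_ineq simp del: ennreal_plus intro!: ennreal_leI)
  also have "\<dots> = (\<Sum>i. ennreal (norm (\<mu> (A i)))) + (\<Sum>i. ennreal (norm (\<nu> (A i))))"
    by (intro suminf_add[symmetric]) auto
  also have "\<dots> \<le> total_variation \<mu> E + total_variation \<nu> E"
    by (intro add_mono total_variation_upper A)
  finally show "(\<Sum>i. ennreal (norm (\<mu> (A i) + \<nu> (A i)))) \<le> total_variation \<mu> E + total_variation \<nu> E" .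
qed

lemma total_variation_scaleR:
  fixes \<mu> :: "'a::topological_space set \<Rightarrow> 'b::real_normed_vector"
  shows "total_variation (\<lambda>E. c *\<^sub>R \<mu> E) E = ennreal \<bar>c\<bar> * total_variation \<mu> E"
proof -
  have "(\<Sum>i. ennreal (norm (c *\<^sub>R \<mu> (A i)))) = ennreal \<bar>c\<bar> * (\<Sum>i. ennreal (norm (\<mu> (A i))))"
    for A :: "nat \<Rightarrow> 'a set"
    unfolding norm_scaleR ennreal_mult'[OF abs_ge_zero] by (rule ennreal_suminf_cmult)
  then show ?thesis
    unfolding total_variation_def SUP_mult_left_ennreal by metis
qed


subsection \<open>The normed space of complex Radon measures\<close>

lemma regular_approx:
  fixes \<mu> :: "'a::t2_space set \<Rightarrow> complex"
  assumes \<mu>: "complex_radon \<mu>" and E: "E \<in> sets borel" and e: "(e::real) > 0"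
  obtains K V where "compact K" "open V" "K \<subseteq> E" "E \<subseteq> V" "total_variation \<mu> (V - K) \<le> ennreal e"
proof -
  let ?M = "variation_measure \<mu>"
  have vm: "vector_measure \<mu>" and reg: "regular_on_borel (total_variation \<mu>)"
    and fin: "total_variation \<mu> UNIV < \<infinity>"
    using \<mu> by (auto simp: complex_radon_def)
  note em = emeasure_variation_measure[OF vm]
  interpret finite_measure ?M
    using fin em[of UNIV] by (intro finite_measureI) simp
  have top: "total_variation \<mu> E \<noteq> \<infinity>"
    using em[OF E] emeasure_finite[of E] by simp
  have "\<exists>V\<in>{V. open V \<and> E \<subseteq> V}. total_variation \<mu> V < total_variation \<mu> E + ennreal (e / 2)"
  proof (rule INF_approx_ennreal)
    show "total_variation \<mu> E = (INF V\<in>{V. open V \<and> E \<subseteq> V}. total_variation \<mu> V)"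
      using reg E unfolding regular_on_borel_def by blast
  qed (use e top in auto)
  then obtain V where V: "open V" "E \<subseteq> V"
    "total_variation \<mu> V < total_variation \<mu> E + ennreal (e / 2)" by blast
  have "\<exists>K\<in>{K. compact K \<and> K \<subseteq> E}. total_variation \<mu> E < total_variation \<mu> K + ennreal (e / 2)"
  proof (rule SUP_approx_ennreal)
    show "total_variation \<mu> E = (SUP K\<in>{K. compact K \<and> K \<subseteq> E}. total_variation \<mu> K)"
      using reg E unfolding regular_on_borel_def by blast
  qed (use e top in auto)
  then obtain K where K: "compact K" "K \<subseteq> E"
    "total_variation \<mu> E < total_variation \<mu> K + ennreal (e / 2)" by blast
  have KV: "K \<in> sets borel" "V \<in> sets borel"
    using K V by (auto intro: borel_closed compact_imp_closed)
  have "ennreal (measure ?M V) < ennreal (measure ?M E + e / 2)"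
    using V(3) e by (simp add: em[symmetric] E KV emeasure_eq_measure)
  then have 1: "measure ?M V < measure ?M E + e / 2"
    by (simp add: ennreal_less_iff)
  have "ennreal (measure ?M E) < ennreal (measure ?M K + e / 2)"
    using K(3) e by (simp add: em[symmetric] E KV emeasure_eq_measure)
  then have 2: "measure ?M E < measure ?M K + e / 2"
    by (simp add: ennreal_less_iff)
  have "measure ?M (V - K) = measure ?M V - measure ?M K"
    using KV K(2) V(2) by (intro finite_measure_Diff) auto
  with 1 2 have "measure ?M (V - K) \<le> e" by simp
  then have "total_variation \<mu> (V - K) \<le> ennreal e"
    using KV by (simp add: em[symmetric] emeasure_eq_measure ennreal_leI)
  with that K V show thesis by blast
qed

lemma regular_on_borelI:
  fixes \<mu> :: "'a::t2_space set \<Rightarrow> complex"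
  assumes \<mu>: "vector_measure \<mu>"
    and approx: "\<And>E e::real. E \<in> sets borel \<Longrightarrow> e > 0 \<Longrightarrow>
      \<exists>K V. compact K \<and> open V \<and> K \<subseteq> E \<and> E \<subseteq> V \<and> total_variation \<mu> (V - K) \<le> ennreal e"
  shows "regular_on_borel (total_variation \<mu>)"
  unfolding regular_on_borel_def
proof (intro ballI conjI)
  have sub: "total_variation \<mu> B \<le> total_variation \<mu> A + total_variation \<mu> C"
    if "A \<in> sets borel" "B \<in> sets borel" "C \<in> sets borel" "B \<subseteq> A \<union> C" for A B C
  proof -
    have "emeasure (variation_measure \<mu>) B \<le> emeasure (variation_measure \<mu>) (A \<union> C)"
      using that by (intro emeasure_mono) auto
    also have "\<dots> \<le> emeasure (variation_measure \<mu>) A + emeasure (variation_measure \<mu>) C"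
      using that by (intro emeasure_subadditive) auto
    finally show ?thesis using that by (simp add: emeasure_variation_measure[OF \<mu>])
  qed
  fix E :: "'a set" assume E: "E \<in> sets borel"
  show "total_variation \<mu> E = (INF V\<in>{V. open V \<and> E \<subseteq> V}. total_variation \<mu> V)"
  proof (rule ennreal_approx_INF)
    show "total_variation \<mu> E \<le> total_variation \<mu> V" if "V \<in> {V. open V \<and> E \<subseteq> V}" for V
      using that E by (intro total_variation_mono) auto
    fix e :: real assume "e > 0"
    from approx[OF E this] obtain K V where *: "compact K" "open V" "K \<subseteq> E" "E \<subseteq> V"
      "total_variation \<mu> (V - K) \<le> ennreal e" by blast
    then have "K \<in> sets borel" "V \<in> sets borel"
      by (auto intro: borel_closed compact_imp_closed)
    then have "total_variation \<mu> V \<le> total_variation \<mu> E + total_variation \<mu> (V - K)"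
      using E * by (intro sub) auto
    also have "\<dots> \<le> total_variation \<mu> E + ennreal e"
      using * by (intro add_left_mono)
    finally show "\<exists>V\<in>{V. open V \<and> E \<subseteq> V}. total_variation \<mu> V \<le> total_variation \<mu> E + ennreal e"
      using * by blast
  qed
  show "total_variation \<mu> E = (SUP K\<in>{K. compact K \<and> K \<subseteq> E}. total_variation \<mu> K)"
  proof (rule ennreal_approx_SUP)
    show "total_variation \<mu> K \<le> total_variation \<mu> E" if "K \<in> {K. compact K \<and> K \<subseteq> E}" for K
      using that E by (intro total_variation_mono) (auto intro: borel_closed compact_imp_closed)
    fix e :: real assume "e > 0"
    from approx[OF E this] obtain K V where *: "compact K" "open V" "K \<subseteq> E" "E \<subseteq> V"
      "total_variation \<mu> (V - K) \<le> ennreal e" by blast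
    then have "K \<in> sets borel" "V \<in> sets borel"
      by (auto intro: borel_closed compact_imp_closed)
    then have "total_variation \<mu> E \<le> total_variation \<mu> K + total_variation \<mu> (V - K)"
      using E * by (intro sub) auto
    also have "\<dots> \<le> total_variation \<mu> K + ennreal e"
      using * by (intro add_left_mono)
    finally show "\<exists>K\<in>{K. compact K \<and> K \<subseteq> E}. total_variation \<mu> E \<le> total_variation \<mu> K + ennreal e"
      using * by blast
  qed
qed

lemma complex_radon_zero: "complex_radon (\<lambda>E :: 'a::t2_space set. 0)"
proof -
  have tv: "total_variation (\<lambda>E :: 'a set. 0 :: complex) E = 0" for E
  proof -
    have "total_variation (\<lambda>E :: 'a set. 0 :: complex) E \<le> 0"
      unfolding total_variation_def by (rule SUP_least) simp
    then show ?thesis by simp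
  qed
  have vm: "vector_measure (\<lambda>E :: 'a set. 0 :: complex)"
    by (simp add: vector_measure_def)
  have "regular_on_borel (total_variation (\<lambda>E :: 'a set. 0 :: complex))"
  proof (rule regular_on_borelI[OF vm])
    fix E :: "'a set" and e :: real
    show "\<exists>K V. compact K \<and> open V \<and> K \<subseteq> E \<and> E \<subseteq> V \<and>
        total_variation (\<lambda>E :: 'a set. 0 :: complex) (V - K) \<le> ennreal e"
      by (rule exI[of _ "{}"], rule exI[of _ UNIV]) (simp add: tv)
  qed
  then show ?thesis by (simp add: complex_radon_def vm tv)
qed

lemma complex_radon_add:
  fixes \<mu> \<nu> :: "'a::t2_space set \<Rightarrow> complex"
  assumes \<mu>: "complex_radon \<mu>" and \<nu>: "complex_radon \<nu>"
  shows "complex_radon (\<lambda>E. \<mu> E + \<nu> E)"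
proof -
  have vm: "vector_measure (\<lambda>E. \<mu> E + \<nu> E)"
    using \<mu> \<nu> by (auto simp: complex_radon_def vector_measure_def intro!: sums_add)
  have "regular_on_borel (total_variation (\<lambda>E. \<mu> E + \<nu> E))"
  proof (rule regular_on_borelI[OF vm])
    fix E :: "'a set" and e :: real assume E: "E \<in> sets borel" and e: "e > 0"
    obtain K V where 1: "compact K" "open V" "K \<subseteq> E" "E \<subseteq> V"
        "total_variation \<mu> (V - K) \<le> ennreal (e / 2)"
      using regular_approx[OF \<mu> E, of "e / 2"] e by auto
    obtain K' V' where 2: "compact K'" "open V'" "K' \<subseteq> E" "E \<subseteq> V'"
        "total_variation \<nu> (V' - K') \<le> ennreal (e / 2)"
      using regular_approx[OF \<nu> E, of "e / 2"] e by auto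
    let ?D = "V \<inter> V' - (K \<union> K')"
    have D: "K \<in> sets borel" "V \<in> sets borel" "K' \<in> sets borel" "V' \<in> sets borel"
      using 1 2 by (auto intro: borel_closed compact_imp_closed)
    have "total_variation (\<lambda>E. \<mu> E + \<nu> E) ?D \<le> total_variation \<mu> ?D + total_variation \<nu> ?D"
      by (rule total_variation_add)
    also have "\<dots> \<le> total_variation \<mu> (V - K) + total_variation \<nu> (V' - K')"
      using D by (intro add_mono total_variation_mono) auto
    also have "\<dots> \<le> ennreal (e / 2) + ennreal (e / 2)"
      using 1 2 by (intro add_mono)
    also have "\<dots> = ennreal e"
      using e by (simp add: ennreal_plus[symmetric] del: ennreal_plus)
    finally have "total_variation (\<lambda>E. \<mu> E + \<nu> E) ?D \<le> ennreal e" .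
    moreover have "compact (K \<union> K')" "open (V \<inter> V')" "K \<union> K' \<subseteq> E" "E \<subseteq> V \<inter> V'"
      using 1 2 by auto
    ultimately show "\<exists>K V. compact K \<and> open V \<and> K \<subseteq> E \<and> E \<subseteq> V \<and>
        total_variation (\<lambda>E. \<mu> E + \<nu> E) (V - K) \<le> ennreal e" by blast
  qed
  moreover have "total_variation (\<lambda>E. \<mu> E + \<nu> E) UNIV < \<infinity>"
    using total_variation_add[of \<mu> \<nu> UNIV] \<mu> \<nu> unfolding complex_radon_def
    by (auto intro: le_less_trans)
  ultimately show ?thesis
    using vm \<mu> \<nu> by (simp add: complex_radon_def)
qed

lemma complex_radon_scaleR:
  fixes \<mu> :: "'a::t2_space set \<Rightarrow> complex"
  assumes \<mu>: "complex_radon \<mu>"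
  shows "complex_radon (\<lambda>E. c *\<^sub>R \<mu> E)"
proof -
  have vm: "vector_measure (\<lambda>E. c *\<^sub>R \<mu> E)"
    unfolding vector_measure_def
  proof (intro allI impI)
    fix A :: "nat \<Rightarrow> 'a set" assume "range A \<subseteq> sets borel" "disjoint_family A"
    then have "(\<lambda>i. \<mu> (A i)) sums \<mu> (\<Union>i. A i)"
      using \<mu> unfolding complex_radon_def vector_measure_def by blast
    then show "(\<lambda>i. c *\<^sub>R \<mu> (A i)) sums (c *\<^sub>R \<mu> (\<Union>i. A i))"
      by (rule sums_scaleR_right)
  qed
  have "regular_on_borel (total_variation (\<lambda>E. c *\<^sub>R \<mu> E))"
  proof (rule regular_on_borelI[OF vm])
    fix E :: "'a set" and e :: real assume E: "E \<in> sets borel" and e: "e > 0"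
    have "e / (\<bar>c\<bar> + 1) > 0" using e by simp
    from regular_approx[OF \<mu> E this] obtain K V where 1: "compact K" "open V" "K \<subseteq> E" "E \<subseteq> V"
        "total_variation \<mu> (V - K) \<le> ennreal (e / (\<bar>c\<bar> + 1))" by metis
    have "total_variation (\<lambda>E. c *\<^sub>R \<mu> E) (V - K) \<le> ennreal \<bar>c\<bar> * ennreal (e / (\<bar>c\<bar> + 1))"
      unfolding total_variation_scaleR by (intro mult_left_mono 1) auto
    also have "\<dots> = ennreal (\<bar>c\<bar> * (e / (\<bar>c\<bar> + 1)))"
      by (rule ennreal_mult'[symmetric]) simp
    also have "\<dots> \<le> ennreal e"
      using e by (intro ennreal_leI) (simp add: field_simps)
    finally show "\<exists>K V. compact K \<and> open V \<and> K \<subseteq> E \<and> E \<subseteq> V \<and>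
        total_variation (\<lambda>E. c *\<^sub>R \<mu> E) (V - K) \<le> ennreal e"
      using 1 by blast
  qed
  moreover have "total_variation (\<lambda>E. c *\<^sub>R \<mu> E) UNIV < \<infinity>"
    unfolding total_variation_scaleR using \<mu> 
    by (simp add: complex_radon_def ennreal_mult_less_top)
  ultimately show ?thesis
    using vm \<mu> by (simp add: complex_radon_def)
qed

typedef (overloaded) 'a radon_measure = "{\<mu> :: 'a::t2_space set \<Rightarrow> complex. complex_radon \<mu>}"
  morphisms charge Abs_radon_measure
  using complex_radon_zero by blast

setup_lifting type_definition_radon_measure

abbreviation abs_measure :: "'a::t2_space radon_measure \<Rightarrow> 'a set \<Rightarrow> ennreal" (\<open>\<bar>_\<bar>\<^sub>m\<close>) where
  "\<bar>\<mu>\<bar>\<^sub>m \<equiv> total_variation (charge \<mu>)"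

lemma complex_radon_charge: "complex_radon (charge \<mu>)"
  using charge by blast

lemma vector_measure_charge: "vector_measure (charge \<mu>)"
  using complex_radon_charge by (auto simp: complex_radon_def)

lemma abs_measure_finite: "\<bar>\<mu>\<bar>\<^sub>m UNIV < \<infinity>"
  using complex_radon_charge[of \<mu>] by (simp add: complex_radon_def)

instantiation radon_measure :: (t2_space) real_vector
begin

lift_definition zero_radon_measure :: "'a radon_measure" is "\<lambda>E. 0"
  by (rule complex_radon_zero)

lift_definition plus_radon_measure ::
    "'a radon_measure \<Rightarrow> 'a radon_measure \<Rightarrow> 'a radon_measure" is "\<lambda>\<mu> \<nu> E. \<mu> E + \<nu> E"
  by (rule complex_radon_add)

lift_definition scaleR_radon_measure ::
    "real \<Rightarrow> 'a radon_measure \<Rightarrow> 'a radon_measure" is "\<lambda>c \<mu> E. c *\<^sub>R \<mu> E"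
  by (rule complex_radon_scaleR)

definition uminus_radon_measure :: "'a radon_measure \<Rightarrow> 'a radon_measure" where
  "- \<mu> = (- 1) *\<^sub>R (\<mu> :: 'a radon_measure)"

definition minus_radon_measure ::
    "'a radon_measure \<Rightarrow> 'a radon_measure \<Rightarrow> 'a radon_measure" where
  "\<mu> - \<nu> = \<mu> + - (\<nu> :: 'a radon_measure)"

instance
proof
  fix \<mu> \<nu> \<rho> :: "'a radon_measure" and a b :: real
  show "\<mu> + \<nu> + \<rho> = \<mu> + (\<nu> + \<rho>)" by transfer (simp add: add.assoc)
  show "\<mu> + \<nu> = \<nu> + \<mu>" by transfer (simp add: add.commute)
  show "0 + \<mu> = \<mu>" by transfer simp
  show "- \<mu> + \<mu> = 0" unfolding uminus_radon_measure_def by transfer simp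
  show "\<mu> - \<nu> = \<mu> + - \<nu>" by (rule minus_radon_measure_def)
  show "a *\<^sub>R (\<mu> + \<nu>) = a *\<^sub>R \<mu> + a *\<^sub>R \<nu>" by transfer (simp add: scaleR_add_right)
  show "(a + b) *\<^sub>R \<mu> = a *\<^sub>R \<mu> + b *\<^sub>R \<mu>" by transfer (simp add: scaleR_add_left)
  show "a *\<^sub>R b *\<^sub>R \<mu> = (a * b) *\<^sub>R \<mu>" by transfer simp
  show "1 *\<^sub>R \<mu> = \<mu>" by transfer simp
qed

end

instantiation radon_measure :: (t2_space) real_normed_vector
begin

definition norm_radon_measure :: "'a radon_measure \<Rightarrow> real" where
  "norm \<mu> = enn2real (\<bar>\<mu>\<bar>\<^sub>m UNIV)"

definition dist_radon_measure :: "'a radon_measure \<Rightarrow> 'a radon_measure \<Rightarrow> real" where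
  "dist \<mu> \<nu> = norm (\<mu> - (\<nu> :: 'a radon_measure))"

definition sgn_radon_measure :: "'a radon_measure \<Rightarrow> 'a radon_measure" where
  "sgn \<mu> = inverse (norm \<mu>) *\<^sub>R (\<mu> :: 'a radon_measure)"

definition uniformity_radon_measure :: "('a radon_measure \<times> 'a radon_measure) filter" where
  "uniformity_radon_measure = (INF e\<in>{0<..}. principal {(\<mu>, \<nu>). dist \<mu> \<nu> < e})"

definition open_radon_measure :: "'a radon_measure set \<Rightarrow> bool" where
  "open_radon_measure U \<longleftrightarrow>
     (\<forall>\<mu>\<in>U. \<forall>\<^sub>F (\<mu>', \<nu>) in uniformity. \<mu>' = \<mu> \<longrightarrow> \<nu> \<in> U)"

instance
proof
  fix \<mu> \<nu> :: "'a radon_measure" and c :: real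
  have fin: "\<bar>\<mu>\<bar>\<^sub>m UNIV \<noteq> top" "\<bar>\<nu>\<bar>\<^sub>m UNIV \<noteq> top"
    using abs_measure_finite[of \<mu>] abs_measure_finite[of \<nu>] by auto
  show "dist \<mu> \<nu> = norm (\<mu> - \<nu>)" by (rule dist_radon_measure_def)
  show "sgn \<mu> = inverse (norm \<mu>) *\<^sub>R \<mu>" by (rule sgn_radon_measure_def)
  show "uniformity = (INF e\<in>{0<..}. principal {(\<mu> :: 'a radon_measure, \<nu>). dist \<mu> \<nu> < e})"
    by (rule uniformity_radon_measure_def)
  show "open U \<longleftrightarrow> (\<forall>\<mu>\<in>U. \<forall>\<^sub>F (\<mu>', \<nu>) in uniformity. \<mu>' = \<mu> \<longrightarrow> \<nu> \<in> U)"
    for U :: "'a radon_measure set" by (rule open_radon_measure_def)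
  show "norm \<mu> = 0 \<longleftrightarrow> \<mu> = 0"
  proof
    assume "norm \<mu> = 0"
    then have 0: "\<bar>\<mu>\<bar>\<^sub>m UNIV = 0"
      using fin by (auto simp: norm_radon_measure_def enn2real_eq_0_iff)
    have "charge \<mu> E = 0" for E
    proof (cases "E \<in> sets borel")
      case True
      have "ennreal (norm (charge \<mu> E)) \<le> \<bar>\<mu>\<bar>\<^sub>m E"
        by (rule norm_le_total_variation[OF vector_measure_charge True])
      also have "\<dots> \<le> \<bar>\<mu>\<bar>\<^sub>m UNIV"
        using True by (intro total_variation_mono) auto
      finally show ?thesis using 0 by simp
    next
      case False
      then show ?thesis using complex_radon_charge[of \<mu>] by (simp add: complex_radon_def)
    qed
    then show "\<mu> = 0"
      by (simp add: charge_inject[symmetric] zero_radon_measure.rep_eq fun_eq_iff)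
  next
    assume "\<mu> = 0"
    then have "\<bar>\<mu>\<bar>\<^sub>m UNIV = ennreal \<bar>0\<bar> * \<bar>\<mu>\<bar>\<^sub>m UNIV"
      unfolding total_variation_scaleR[symmetric] by (simp add: zero_radon_measure.rep_eq)
    then show "norm \<mu> = 0" by (simp add: norm_radon_measure_def)
  qed
  show "norm (\<mu> + \<nu>) \<le> norm \<mu> + norm \<nu>"
  proof -
    have "\<bar>\<mu> + \<nu>\<bar>\<^sub>m UNIV \<le> \<bar>\<mu>\<bar>\<^sub>m UNIV + \<bar>\<nu>\<bar>\<^sub>m UNIV"
      unfolding plus_radon_measure.rep_eq by (rule total_variation_add)
    then have "enn2real (\<bar>\<mu> + \<nu>\<bar>\<^sub>m UNIV) \<le> enn2real (\<bar>\<mu>\<bar>\<^sub>m UNIV + \<bar>\<nu>\<bar>\<^sub>m UNIV)"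
      using fin by (intro enn2real_mono) (auto simp: less_top)
    also have "\<dots> = enn2real (\<bar>\<mu>\<bar>\<^sub>m UNIV) + enn2real (\<bar>\<nu>\<bar>\<^sub>m UNIV)"
      using fin by (intro enn2real_plus) (auto simp: less_top)
    finally show ?thesis by (simp add: norm_radon_measure_def)
  qed
  show "norm (c *\<^sub>R \<mu>) = \<bar>c\<bar> * norm \<mu>"
    unfolding norm_radon_measure_def scaleR_radon_measure.rep_eq total_variation_scaleR
    by (simp add: enn2real_mult)
qed

end


section \<open>Integration and adjoints\<close>

text \<open>
  Jordan decomposition: for a real measure \<open>\<sigma>\<close> the positive part is
  \<open>\<sigma>\<^sup>+ = (|\<sigma>| + \<sigma>) / 2\<close>, and the negative part is \<open>(-\<sigma>)\<^sup>+\<close>.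
\<close>

definition positive_part :: "('a::topological_space set \<Rightarrow> real) \<Rightarrow> 'a measure" where
  "positive_part \<sigma> =
     measure_of UNIV (sets borel) (\<lambda>E. ennreal ((enn2real (total_variation \<sigma> E) + \<sigma> E) / 2))"

definition signed_integral ::
    "('a::topological_space set \<Rightarrow> real) \<Rightarrow> ('a \<Rightarrow> complex) \<Rightarrow> complex" where
  "signed_integral \<sigma> f =
     (LINT x|positive_part \<sigma>. f x) - (LINT x|positive_part (\<lambda>E. - \<sigma> E). f x)"

definition radon_integral :: "'a::t2_space radon_measure \<Rightarrow> ('a \<Rightarrow> complex) \<Rightarrow> complex" where
  "radon_integral \<mu> f =
     signed_integral (\<lambda>E. Re (charge \<mu> E)) f + \<i> * signed_integral (\<lambda>E. Im (charge \<mu> E)) f"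

definition C0 :: "('a::topological_space \<Rightarrow> complex) set" where
  "C0 = {f. continuous_on UNIV f \<and> (\<forall>e>0. \<exists>K. compact K \<and> (\<forall>x. x \<notin> K \<longrightarrow> norm (f x) < e))}"

text \<open>
  The adjoint, under the identification of the measures with the dual of \<open>C0\<close>. On a locally
  compact space it exists and is unique for every bounded operator on \<open>C0\<close> by the
  Riesz representation theorem.
\<close>

definition adjoint_on_measures ::
    "(('a \<Rightarrow> complex) \<Rightarrow> ('a \<Rightarrow> complex)) \<Rightarrow> 'a::t2_space radon_measure \<Rightarrow> 'a radon_measure" where
  "adjoint_on_measures T \<mu> = (THE \<nu>. \<forall>f\<in>C0. radon_integral \<nu> f = radon_integral \<mu> (T f))"


section \<open>Weighted composition operators\<close>

definition weighted_comp ::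
    "('a \<Rightarrow> 'a) \<Rightarrow> ('a \<Rightarrow> real) \<Rightarrow> ('a \<Rightarrow> complex) \<Rightarrow> ('a \<Rightarrow> complex)" where
  "weighted_comp \<alpha> w f = (\<lambda>x. complex_of_real (w x) * f (\<alpha> x))"

definition weighted_comp_inv ::
    "('a \<Rightarrow> 'a) \<Rightarrow> ('a \<Rightarrow> real) \<Rightarrow> ('a \<Rightarrow> complex) \<Rightarrow> ('a \<Rightarrow> complex)" where
  "weighted_comp_inv \<alpha> w f = (\<lambda>x. f (inv \<alpha> x) / complex_of_real (w (inv \<alpha> x)))"

definition cosine_adjoint ::
    "('a \<Rightarrow> 'a) \<Rightarrow> ('a \<Rightarrow> real) \<Rightarrow> nat \<Rightarrow> 'a::t2_space radon_measure \<Rightarrow> 'a radon_measure" where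
  "cosine_adjoint \<alpha> w n \<mu> = (1 / 2) *\<^sub>R
     ((adjoint_on_measures (weighted_comp \<alpha> w) ^^ n) \<mu> +
      (adjoint_on_measures (weighted_comp_inv \<alpha> w) ^^ n) \<mu>)"

definition aperiodic :: "('a::topological_space \<Rightarrow> 'a) \<Rightarrow> bool" where
  "aperiodic \<alpha> \<longleftrightarrow> (\<forall>K. compact K \<longrightarrow> (\<exists>N>0. \<forall>n\<ge>N. K \<inter> (\<alpha> ^^ n) ` K = {}))"

definition hyper_transitive :: "(nat \<Rightarrow> 'b::real_normed_vector \<Rightarrow> 'b) \<Rightarrow> bool" where
  "hyper_transitive T \<longleftrightarrow>
     (\<forall>U V. open U \<longrightarrow> U \<noteq> {} \<longrightarrow> open V \<longrightarrow> V \<noteq> {} \<longrightarrow>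
       (\<exists>n::nat \<Rightarrow> nat. strict_mono n \<and> (\<forall>k. n k \<ge> 1) \<and> (\<forall>k. T (n k) ` U \<inter> V \<noteq> {})))"

end

theory Submission
  imports Defs
begin

text \<open>
  By Radon--Nikodym every complex Radon measure is \<open>h \<rho>\<close> with \<open>h\<close> bounded and \<open>\<rho>\<close> a finite positive
  measure, so integration against it is a single Bochner integral. Consequently the
  adjoints are explicit: multiplying by a bounded weight and pushing forward along a homeomorphism is
  adjoint to a weighted composition operator, and on a locally compact space \<open>C0\<close> separates
  Radon measures, by Urysohn's lemma and regularity. In particular the adjoints \<open>T\<close> and \<open>S\<close> are
  mutually inverse, and the norm of \<open>T\<^sup>n (\<mu> restricted to B)\<close> is at most a constant times the norm
  of \<open>\<mu>\<close> times the supremum over \<open>B\<close> of the product of the weights.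

  Measures with compact support are dense. Given two of them, \<open>\<mu>\<close> and \<open>\<nu>\<close>, carried by \<open>K\<close>, put
  \<open>B = K - A = F \<union> D\<close> and \<open>x = \<mu>|B + 2 T\<^sup>n (\<nu>|F) + 2 S\<^sup>n (\<nu>|D)\<close>. Then \<open>x\<close> is close to \<open>\<mu>\<close>, and
  \<open>(T\<^sup>n x + S\<^sup>n x) / 2 = (T\<^sup>n (\<mu>|B) + S\<^sup>n (\<mu>|B)) / 2 + T\<^sup>2\<^sup>n (\<nu>|F) + S\<^sup>2\<^sup>n (\<nu>|D) + \<nu>|B\<close> is close to \<open>\<nu>\<close>.
\<close>

section \<open>Vector measures and positive parts\<close>

text \<open>The variation of a pair of measures dominates the variation of each component, so two
  complex measures obtain densities against one common base measure.\<close>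

lemma vector_measure_Pair:
  fixes \<mu> :: "'a::topological_space set \<Rightarrow> 'b::real_normed_vector"
    and \<nu> :: "'a set \<Rightarrow> 'c::real_normed_vector"
  assumes "vector_measure \<mu>" "vector_measure \<nu>"
  shows "vector_measure (\<lambda>E. (\<mu> E, \<nu> E))"
  unfolding vector_measure_def
proof (intro allI impI)
  fix A :: "nat \<Rightarrow> 'a set" assume "range A \<subseteq> sets borel" "disjoint_family A"
  then have "(\<lambda>i. \<mu> (A i)) sums \<mu> (\<Union>i. A i)" "(\<lambda>i. \<nu> (A i)) sums \<nu> (\<Union>i. A i)"
    using assms unfolding vector_measure_def by blast+
  then show "(\<lambda>i. (\<mu> (A i), \<nu> (A i))) sums (\<mu> (\<Union>i. A i), \<nu> (\<Union>i. A i))"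
    unfolding sums_def sum_prod by (rule tendsto_Pair)
qed

lemma total_variation_norm_mono:
  assumes "\<And>E. norm (\<mu> E) \<le> norm (\<nu> E)"
  shows "total_variation \<mu> E \<le> total_variation \<nu> E"
  unfolding total_variation_def by (intro SUP_mono') (intro suminf_le ennreal_leI assms summableI)

text \<open>The variation is the least positive measure dominating the norm: countable additivity of
  \<open>m\<close> sums the bounds on the pieces of any partition to
  \<open>emeasure m E\<close>.\<close>

lemma total_variation_le_emeasure:
  assumes le: "\<And>E. E \<in> sets borel \<Longrightarrow> ennreal (norm (\<mu> E)) \<le> emeasure m E"
    and m: "sets m = sets borel"
  shows "total_variation \<mu> E \<le> emeasure m E"
  unfolding total_variation_def
proof (rule SUP_least)
  fix A assume "A \<in> borel_partitions E"
  then have A: "range A \<subseteq> sets borel" "disjoint_family A" "(\<Union>i. A i) = E"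
    by (auto simp: borel_partitions_def)
  have "(\<Sum>i. ennreal (norm (\<mu> (A i)))) \<le> (\<Sum>i. emeasure m (A i))"
    using A by (intro suminf_le le summableI) auto
  also have "\<dots> = emeasure m E"
    using suminf_emeasure[of A m] A m by auto
  finally show "(\<Sum>i. ennreal (norm (\<mu> (A i)))) \<le> emeasure m E" .
qed

lemma total_variation_cong:
  assumes "\<And>E. norm (\<mu> E) = norm (\<nu> E)"
  shows "total_variation \<mu> = total_variation \<nu>"
  using assms by (intro ext antisym total_variation_norm_mono) auto

lemma finite_measure_variation:
  assumes "vector_measure \<mu>" "total_variation \<mu> UNIV < \<infinity>"
  shows "finite_measure (variation_measure \<mu>)"
  using assms emeasure_variation_measure[of \<mu> UNIV] by (intro finite_measureI) auto

lemma measure_variation: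
  assumes "vector_measure \<mu>" "E \<in> sets borel"
  shows "measure (variation_measure \<mu>) E = enn2real (total_variation \<mu> E)"
  using assms by (simp add: measure_def emeasure_variation_measure)

lemma vector_measure_bounded_linear:
  assumes "vector_measure \<mu>" "bounded_linear f"
  shows "vector_measure (\<lambda>E. f (\<mu> E))"
  using assms unfolding vector_measure_def by (metis bounded_linear.sums)

text \<open>Dominated convergence with majorant \<open>norm (f x)\<close>: for disjoint sets the
  partial sums of the indicators stay between 0 and 1.\<close>

lemma vector_measure_set_integral:
  fixes f :: "'a::topological_space \<Rightarrow> 'b::{banach,second_countable_topology}"
  assumes \<rho>: "sets \<rho> = sets borel" and f: "integrable \<rho> f"
    and \<mu>: "\<And>E. E \<in> sets borel \<Longrightarrow> \<mu> E = (LINT x:E|\<rho>. f x)"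
  shows "vector_measure \<mu>"
  unfolding vector_measure_def
proof (intro allI impI)
  fix A :: "nat \<Rightarrow> 'a set" assume A: "range A \<subseteq> sets borel" "disjoint_family A"
  have [measurable]: "A i \<in> sets \<rho>" "(\<Union>i. A i) \<in> sets \<rho>" for i using A \<rho> by auto
  have [measurable]: "f \<in> borel_measurable \<rho>" using f by auto
  have si: "(\<lambda>i. indicator (A i) x :: real) sums indicator (\<Union>i. A i) x" for x
    using A by (intro indicator_sums) (auto simp: disjoint_family_on_def)
  have "(\<lambda>n. LINT x|\<rho>. (\<Sum>i<n. indicator (A i) x *\<^sub>R f x)) \<longlonglongrightarrow> (LINT x|\<rho>. indicator (\<Union>i. A i) x *\<^sub>R f x)"
  proof (rule integral_dominated_convergence[where w = "\<lambda>x. norm (f x)"])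
    show "AE x in \<rho>. (\<lambda>n. \<Sum>i<n. indicator (A i) x *\<^sub>R f x) \<longlonglongrightarrow> indicator (\<Union>i. A i) x *\<^sub>R f x"
      using si by (intro AE_I2) (auto simp: sums_def scaleR_left.sum[symmetric] intro!: tendsto_scaleR)
    fix n
    have "(\<Sum>i<n. indicator (A i) x :: real) \<le> 1" for x
    proof -
      have "(\<Sum>i<n. indicator (A i) x :: real) \<le> (\<Sum>i. indicator (A i) x)"
        using si[of x] by (intro sum_le_suminf) (auto simp: sums_iff)
      also have "\<dots> \<le> 1" using si[of x] by (auto simp: sums_iff indicator_def)
      finally show ?thesis .
    qed
    then have "norm (\<Sum>i<n. indicator (A i) x *\<^sub>R f x) \<le> norm (f x)" for x
      by (auto simp: scaleR_left.sum[symmetric] abs_of_nonneg sum_nonneg mult_left_le_one_le)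
    then show "AE x in \<rho>. norm (\<Sum>i<n. indicator (A i) x *\<^sub>R f x) \<le> norm (f x)" by simp
    show "(\<lambda>x. \<Sum>i<n. indicator (A i) x *\<^sub>R f x) \<in> borel_measurable \<rho>" by measurable
    show "(\<lambda>x. indicator (\<Union>i. A i) x *\<^sub>R f x) \<in> borel_measurable \<rho>" by measurable
    show "integrable \<rho> (\<lambda>x. norm (f x))" using f by simp
  qed
  moreover have "(LINT x|\<rho>. (\<Sum>i<n. indicator (A i) x *\<^sub>R f x)) = (\<Sum>i<n. \<mu> (A i))" for n
  proof -
    have "(LINT x|\<rho>. (\<Sum>i<n. indicator (A i) x *\<^sub>R f x)) = (\<Sum>i<n. LINT x|\<rho>. indicator (A i) x *\<^sub>R f x)"
      using f by (intro Bochner_Integration.integral_sum integrable_mult_indicator) auto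
    then show ?thesis using A by (simp add: \<mu> set_lebesgue_integral_def range_subsetD)
  qed
  moreover have "(\<Union>i. A i) \<in> sets borel" using A by auto
  ultimately show "(\<lambda>i. \<mu> (A i)) sums \<mu> (\<Union>i. A i)"
    by (simp add: sums_def \<mu> set_lebesgue_integral_def)
qed

lemma norm_set_integral_le:
  fixes f :: "'a \<Rightarrow> 'b::{banach,second_countable_topology}"
  assumes "integrable \<rho> f" "E \<in> sets \<rho>"
  shows "ennreal (norm (LINT x:E|\<rho>. f x)) \<le> (\<integral>\<^sup>+x\<in>E. ennreal (norm (f x)) \<partial>\<rho>)"
proof -
  have "ennreal (norm (LINT x:E|\<rho>. f x)) \<le> (\<integral>\<^sup>+x. ennreal (norm (indicator E x *\<^sub>R f x)) \<partial>\<rho>)"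
    unfolding set_lebesgue_integral_def
    by (intro integral_norm_bound_ennreal integrable_mult_indicator assms)
  also have "\<dots> = (\<integral>\<^sup>+x\<in>E. ennreal (norm (f x)) \<partial>\<rho>)"
    by (intro nn_integral_cong) (simp split: split_indicator)
  finally show ?thesis .
qed

text \<open>The positive measure with density \<open>norm (f x)\<close> against
  \<open>\<rho>\<close> dominates the norm of every set integral, hence the variation.\<close>

lemma total_variation_set_integral_le:
  fixes f :: "'a::topological_space \<Rightarrow> 'b::{banach,second_countable_topology}"
  assumes \<rho>: "sets \<rho> = sets borel" and f: "integrable \<rho> f" and E: "E \<in> sets borel"
    and \<mu>: "\<And>E. E \<in> sets borel \<Longrightarrow> \<mu> E = (LINT x:E|\<rho>. f x)"
  shows "total_variation \<mu> E \<le> (\<integral>\<^sup>+x\<in>E. ennreal (norm (f x)) \<partial>\<rho>)"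
proof -
  have "total_variation \<mu> E \<le> emeasure (density \<rho> (\<lambda>x. ennreal (norm (f x)))) E"
    using assms norm_set_integral_le[OF f]
    by (intro total_variation_le_emeasure) (auto simp: emeasure_density)
  then show ?thesis using assms by (simp add: emeasure_density)
qed

section \<open>Jordan decomposition of a real measure and its densities\<close>

lemma
  fixes \<sigma> :: "'a::topological_space set \<Rightarrow> real"
  shows space_positive_part [simp]: "space (positive_part \<sigma>) = UNIV"
    and sets_positive_part [simp, measurable_cong]: "sets (positive_part \<sigma>) = sets borel"
  using sets.sigma_sets_eq[of "borel :: 'a measure"]
  by (simp_all add: positive_part_def space_measure_of_conv sets_measure_of_conv)

lemma abs_le_total_variation:
  fixes \<sigma> :: "'a::topological_space set \<Rightarrow> real"
  assumes \<sigma>: "vector_measure \<sigma>" "total_variation \<sigma> UNIV < \<infinity>" and E: "E \<in> sets borel"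
  shows "\<bar>\<sigma> E\<bar> \<le> enn2real (total_variation \<sigma> E)"
proof -
  have "total_variation \<sigma> E < \<infinity>"
    using total_variation_mono[of E UNIV \<sigma>] E \<sigma>(2) by (auto intro: le_less_trans)
  then show ?thesis
    using norm_le_total_variation[OF \<sigma>(1) E] enn2real_mono by fastforce
qed

text \<open>\<open>measure_of\<close> returns the prescribed values only for a positive, countably
  additive set function. Additivity holds because \<open>|\<sigma>|\<close> is finite and both
  summands are additive; the half-sum is nonnegative because \<open>\<bar>\<sigma> E\<bar>\<close>
  is at most the variation of \<open>E\<close>, which also lets the real series pass to
  \<open>ennreal\<close>.\<close>

lemma emeasure_positive_part:
  fixes \<sigma> :: "'a::topological_space set \<Rightarrow> real"
  assumes \<sigma>: "vector_measure \<sigma>" "total_variation \<sigma> UNIV < \<infinity>" and E: "E \<in> sets borel"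
  shows "emeasure (positive_part \<sigma>) E = ennreal ((enn2real (total_variation \<sigma> E) + \<sigma> E) / 2)"
    (is "_ = ?m E")
  unfolding positive_part_def
proof (rule emeasure_measure_of_sigma)
  interpret finite_measure "variation_measure \<sigma>" by (rule finite_measure_variation[OF \<sigma>])
  show "sigma_algebra UNIV (sets (borel :: 'a measure))"
    using sets.sigma_algebra_axioms[of "borel :: 'a measure"] by simp
  show "positive (sets borel) ?m"
    using \<sigma> by (simp add: positive_def total_variation_empty vector_measure_empty)
  show "countably_additive (sets borel) ?m"
    unfolding countably_additive_def
  proof (intro allI impI)
    fix A :: "nat \<Rightarrow> 'a set"
    assume A: "range A \<subseteq> sets borel" "disjoint_family A" "\<Union> (range A) \<in> sets borel"
    have "(\<lambda>i. enn2real (total_variation \<sigma> (A i))) sums enn2real (total_variation \<sigma> (\<Union> (range A)))"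
      using finite_measure_UNION[of A] A by (simp add: measure_variation[OF \<sigma>(1)] range_subsetD)
    moreover have "(\<lambda>i. \<sigma> (A i)) sums \<sigma> (\<Union> (range A))"
      using \<sigma>(1) A unfolding vector_measure_def by blast
    ultimately have s: "(\<lambda>i. (enn2real (total_variation \<sigma> (A i)) + \<sigma> (A i)) / 2) sums
        ((enn2real (total_variation \<sigma> (\<Union> (range A))) + \<sigma> (\<Union> (range A))) / 2)"
      by (intro sums_divide sums_add)
    have nn: "0 \<le> (enn2real (total_variation \<sigma> (A i)) + \<sigma> (A i)) / 2" for i
      using abs_le_total_variation[OF \<sigma>, of "A i"] A(1) by (auto simp: range_subsetD)
    show "(\<Sum>i. ?m (A i)) = ?m (\<Union> (range A))"
      by (rule trans[OF suminf_ennreal2[OF nn sums_summable[OF s]] arg_cong[where f = ennreal, OF sums_unique[OF s, symmetric]]])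
  qed
qed (use E in auto)

lemma measure_positive_part:
  fixes \<sigma> :: "'a::topological_space set \<Rightarrow> real"
  assumes \<sigma>: "vector_measure \<sigma>" "total_variation \<sigma> UNIV < \<infinity>" and E: "E \<in> sets borel"
  shows "measure (positive_part \<sigma>) E = (enn2real (total_variation \<sigma> E) + \<sigma> E) / 2"
  using abs_le_total_variation[OF assms] by (simp add: measure_def emeasure_positive_part[OF assms])

lemma emeasure_positive_part_le:
  fixes \<sigma> :: "'a::topological_space set \<Rightarrow> real"
  assumes \<sigma>: "vector_measure \<sigma>" "total_variation \<sigma> UNIV < \<infinity>" and E: "E \<in> sets borel"
  shows "emeasure (positive_part \<sigma>) E \<le> total_variation \<sigma> E"
proof -
  have "ennreal ((enn2real (total_variation \<sigma> E) + \<sigma> E) / 2) \<le> ennreal (enn2real (total_variation \<sigma> E))"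
    using abs_le_total_variation[OF assms] by (intro ennreal_leI) auto
  also have "\<dots> \<le> total_variation \<sigma> E" by (simp add: ennreal_enn2real_if)
  finally show ?thesis by (simp add: emeasure_positive_part[OF assms])
qed

lemma finite_measure_positive_part:
  fixes \<sigma> :: "'a::topological_space set \<Rightarrow> real"
  assumes "vector_measure \<sigma>" "total_variation \<sigma> UNIV < \<infinity>"
  shows "finite_measure (positive_part \<sigma>)"
  using emeasure_positive_part[OF assms, of UNIV] by (intro finite_measureI) auto

lemma
  fixes \<sigma> :: "'a::topological_space set \<Rightarrow> real"
  shows total_variation_uminus: "total_variation (\<lambda>E. - \<sigma> E) = total_variation \<sigma>"
    and vector_measure_uminus: "vector_measure \<sigma> \<Longrightarrow> vector_measure (\<lambda>E. - \<sigma> E)"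
  using vector_measure_bounded_linear[OF _ bounded_linear_minus[OF bounded_linear_ident]]
  by (auto intro: total_variation_cong)

text \<open>The positive part lies below the variation and so inherits absolute continuity with
  respect to \<open>\<rho>\<close>; Radon-Nikodym then gives a density. Finiteness of the positive
  part makes this density real-valued and integrable.\<close>

lemma positive_part_density:
  fixes \<sigma> :: "'a::topological_space set \<Rightarrow> real"
  assumes \<sigma>: "vector_measure \<sigma>" "total_variation \<sigma> UNIV < \<infinity>"
    and \<rho>: "finite_measure \<rho>" "sets \<rho> = sets borel"
    and null: "\<And>E. E \<in> sets borel \<Longrightarrow> emeasure \<rho> E = 0 \<Longrightarrow> total_variation \<sigma> E = 0"
  shows "\<exists>p. integrable \<rho> p \<and> (\<forall>x. 0 \<le> p x) \<and>
    positive_part \<sigma> = density \<rho> (\<lambda>x. ennreal (p x)) \<and>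
    (\<forall>E\<in>sets borel. measure (positive_part \<sigma>) E = (LINT x:E|\<rho>. p x))"
proof -
  interpret finite_measure \<rho> by fact
  interpret P: finite_measure "positive_part \<sigma>" by (rule finite_measure_positive_part[OF \<sigma>])
  have ac: "absolutely_continuous \<rho> (positive_part \<sigma>)"
    unfolding absolutely_continuous_def
  proof
    fix E assume E: "E \<in> null_sets \<rho>"
    then have "E \<in> sets borel" using \<rho> by auto
    then show "E \<in> null_sets (positive_part \<sigma>)"
      using E null[of E] emeasure_positive_part_le[OF \<sigma>, of E] by (auto simp: null_sets_def)
  qed
  obtain p where p: "p \<in> borel_measurable \<rho>" "AE x in \<rho>. RN_deriv \<rho> (positive_part \<sigma>) x = ennreal (p x)"
      "\<And>x. 0 \<le> p x"
    by (rule real_RN_deriv[OF P.finite_measure_axioms ac]) (use \<rho> in simp_all)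
  note [measurable] = p(1)
  have "positive_part \<sigma> = density \<rho> (RN_deriv \<rho> (positive_part \<sigma>))"
    using density_RN_deriv[OF ac] \<rho> by simp
  also have "\<dots> = density \<rho> (\<lambda>x. ennreal (p x))"
    using p by (intro density_cong) auto
  finally have d: "positive_part \<sigma> = density \<rho> (\<lambda>x. ennreal (p x))" .
  have "(\<integral>\<^sup>+x. ennreal (p x) \<partial>\<rho>) = emeasure (positive_part \<sigma>) UNIV"
    using sets_eq_imp_space_eq[OF \<rho>(2)] \<rho>(2) unfolding d by (subst emeasure_density) (auto)
  then have int: "integrable \<rho> p"
    using p P.emeasure_finite[of UNIV] by (intro integrableI_nonneg) (auto simp: less_top[symmetric])
  have "measure (positive_part \<sigma>) E = (LINT x:E|\<rho>. p x)" if E: "E \<in> sets borel" for E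
  proof -
    have "emeasure (positive_part \<sigma>) E = (\<integral>\<^sup>+x. ennreal (indicator E x * p x) \<partial>\<rho>)"
      using E \<rho>(2) unfolding d by (subst emeasure_density) (auto intro!: nn_integral_cong split: split_indicator)
    also have "\<dots> = ennreal (LINT x|\<rho>. indicator E x * p x)"
      using integrable_mult_indicator[OF _ int, of E] E p(3) \<rho>(2) by (intro nn_integral_eq_integral) auto
    finally show ?thesis
      using p(3) by (simp add: measure_def set_lebesgue_integral_def)
  qed
  with int p(3) d show ?thesis by blast
qed

text \<open>The densities \<open>p\<close> and \<open>q\<close> of the two Jordan parts are not
  computed from \<open>r\<close>. It suffices that \<open>p - q = r\<close> almost everywhere, which
  follows from equality of all set integrals; the integral is then linear in the density.\<close>

lemma signed_integral_density:
  fixes \<sigma> :: "'a::topological_space set \<Rightarrow> real"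
  assumes \<rho>: "finite_measure \<rho>" "sets \<rho> = sets borel" and r: "integrable \<rho> r"
    and \<sigma>: "\<And>E. E \<in> sets borel \<Longrightarrow> \<sigma> E = (LINT x:E|\<rho>. r x)"
    and f: "f \<in> borel_measurable borel" "bounded (range f)"
  shows "signed_integral \<sigma> f = (LINT x|\<rho>. r x *\<^sub>R f x)"
proof -
  interpret finite_measure \<rho> by fact
  have vm: "vector_measure \<sigma>" by (rule vector_measure_set_integral[OF \<rho>(2) r \<sigma>])
  have tv: "total_variation \<sigma> E \<le> (\<integral>\<^sup>+x\<in>E. ennreal (norm (r x)) \<partial>\<rho>)" if "E \<in> sets borel" for E
    by (rule total_variation_set_integral_le[OF \<rho>(2) r that \<sigma>])
  have "total_variation \<sigma> UNIV \<le> (\<integral>\<^sup>+x. ennreal (norm (r x)) \<partial>\<rho>)" using tv[of UNIV] by simp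
  also have "\<dots> < \<infinity>" using r by (auto simp: integrable_iff_bounded)
  finally have fin: "total_variation \<sigma> UNIV < \<infinity>" .
  have null: "total_variation \<sigma> E = 0" if "E \<in> sets borel" "emeasure \<rho> E = 0" for E
  proof -
    have "E \<in> null_sets \<rho>" using that \<rho> by auto
    then show ?thesis using tv[OF that(1)] nn_integral_null_set[of E \<rho>] by simp
  qed
  obtain p where p: "integrable \<rho> p" "\<And>x. 0 \<le> p x"
    "positive_part \<sigma> = density \<rho> (\<lambda>x. ennreal (p x))"
    "\<And>E. E \<in> sets borel \<Longrightarrow> measure (positive_part \<sigma>) E = (LINT x:E|\<rho>. p x)"
    using positive_part_density[OF vm fin \<rho>] null by auto
  have vm': "vector_measure (\<lambda>E. - \<sigma> E)" and fin': "total_variation (\<lambda>E. - \<sigma> E) UNIV < \<infinity>"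
    using vm fin by (simp_all add: vector_measure_uminus total_variation_uminus)
  obtain q where q: "integrable \<rho> q" "\<And>x. 0 \<le> q x"
    "positive_part (\<lambda>E. - \<sigma> E) = density \<rho> (\<lambda>x. ennreal (q x))"
    "\<And>E. E \<in> sets borel \<Longrightarrow> measure (positive_part (\<lambda>E. - \<sigma> E)) E = (LINT x:E|\<rho>. q x)"
    using positive_part_density[OF vm' fin' \<rho>, unfolded total_variation_uminus] null by auto
  have si: "set_integrable \<rho> E g" if "integrable \<rho> g" "E \<in> sets borel" for E and g :: "'a \<Rightarrow> real"
    unfolding set_integrable_def using that \<rho>(2) by (intro integrable_mult_indicator) auto
  have "AE x in \<rho>. p x - q x = r x"
  proof (rule density_unique_real)
    fix E assume "E \<in> sets \<rho>"
    then have E: "E \<in> sets borel" using \<rho> by simp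
    have "(LINT x:E|\<rho>. p x - q x) = (LINT x:E|\<rho>. p x) - (LINT x:E|\<rho>. q x)"
      using p(1) q(1) E by (intro set_integral_diff si)
    \<comment> \<open>The variation cancels: half of \<open>|\<sigma>| + \<sigma>\<close> minus half
      of \<open>|\<sigma>| - \<sigma>\<close> is \<open>\<sigma>\<close>.\<close>
    also have "\<dots> = \<sigma> E"
      unfolding p(4)[OF E, symmetric] q(4)[OF E, symmetric] measure_positive_part[OF vm fin E]
        measure_positive_part[OF vm' fin' E] total_variation_uminus by (simp add: field_simps)
    finally show "(LINT x:E|\<rho>. p x - q x) = (LINT x:E|\<rho>. r x)" using \<sigma>[OF E] by simp
  qed (use p q r in auto)
  have [measurable]: "p \<in> borel_measurable \<rho>" "q \<in> borel_measurable \<rho>" "r \<in> borel_measurable \<rho>"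
    using p q r by auto
  have [measurable]: "f \<in> borel_measurable \<rho>" using f \<rho>(2) by (simp add: measurable_def sets_eq_imp_space_eq)
  obtain B where B: "\<And>x. norm (f x) \<le> B" using f(2) by (auto simp: bounded_iff)
  have int: "integrable \<rho> (\<lambda>x. g x *\<^sub>R f x)" if g: "integrable \<rho> g" for g :: "'a \<Rightarrow> real"
  proof (rule Bochner_Integration.integrable_bound)
    show "integrable \<rho> (\<lambda>x. B * g x)" using g by simp
    have "B \<ge> 0" using B[of undefined] norm_ge_zero[of "f undefined"] by linarith
    then have "norm (g x *\<^sub>R f x) \<le> norm (B * g x)" for x
      using B[of x] by (simp add: abs_mult mult.commute[of B] mult_left_mono)
    then show "AE x in \<rho>. norm (g x *\<^sub>R f x) \<le> norm (B * g x)" by simp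
  qed (use g in auto)
  have "signed_integral \<sigma> f = (LINT x|\<rho>. p x *\<^sub>R f x) - (LINT x|\<rho>. q x *\<^sub>R f x)"
    unfolding signed_integral_def p(3) q(3) using p(2) q(2) by (subst (1 2) integral_density) auto
  also have "\<dots> = (LINT x|\<rho>. p x *\<^sub>R f x - q x *\<^sub>R f x)"
    using int p(1) q(1) by simp
  also have "\<dots> = (LINT x|\<rho>. r x *\<^sub>R f x)"
    using \<open>AE x in \<rho>. p x - q x = r x\<close> by (intro integral_cong_AE) (auto simp flip: scaleR_diff_left)
  finally show ?thesis .
qed

section \<open>Bounded densities\<close>

text \<open>This class contains \<open>C0\<close> as well as the indicators of Borel sets, so one
  integration formula covers both the pairing with \<open>C0\<close> and the values of a
  measure.\<close>

definition bdd_borel :: "('a::topological_space \<Rightarrow> complex) \<Rightarrow> bool" where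
  "bdd_borel f \<longleftrightarrow> f \<in> borel_measurable borel \<and> bounded (range f)"

lemma bdd_borelI: "f \<in> borel_measurable borel \<Longrightarrow> (\<And>x. norm (f x) \<le> B) \<Longrightarrow> bdd_borel f"
  by (auto simp: bdd_borel_def bounded_iff)

lemma bdd_borel_bound:
  assumes "bdd_borel f" obtains B where "B > 0" "\<And>x. norm (f x) \<le> B"
  using assms by (auto simp: bdd_borel_def bounded_pos)

lemma bdd_borel_mult:
  assumes "bdd_borel f" "bdd_borel g" shows "bdd_borel (\<lambda>x. f x * g x)"
proof -
  obtain B C where "B > 0" "C > 0" "\<And>x. norm (f x) \<le> B" "\<And>x. norm (g x) \<le> C"
    using assms by (metis bdd_borel_bound)
  then show ?thesis
    using assms by (intro bdd_borelI[where B = "B * C"])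
      (auto simp: bdd_borel_def norm_mult less_imp_le intro!: mult_mono)
qed

lemma bdd_borel_add:
  assumes "bdd_borel f" "bdd_borel g" shows "bdd_borel (\<lambda>x. f x + g x)"
proof -
  obtain B C where "\<And>x. norm (f x) \<le> B" "\<And>x. norm (g x) \<le> C"
    using assms by (metis bdd_borel_bound)
  then show ?thesis
    using assms by (intro bdd_borelI[where B = "B + C"])
      (auto simp: bdd_borel_def intro!: norm_triangle_mono)
qed

lemma bdd_borel_indicator: "E \<in> sets borel \<Longrightarrow> bdd_borel (indicator E)"
  by (rule bdd_borelI[where B = 1]) (auto simp: indicator_def)

lemma bdd_borel_const: "bdd_borel (\<lambda>x. c)"
  by (rule bdd_borelI[where B = "norm c"]) auto

lemma homeomorphism_measurable:
  "homeomorphism UNIV UNIV \<phi> \<psi> \<Longrightarrow> \<phi> \<in> borel_measurable borel"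
  by (auto simp: homeomorphism_def intro: borel_measurable_continuous_onI)

lemma homeomorphism_vimage:
  assumes "homeomorphism UNIV UNIV \<phi> \<psi>" "E \<in> sets borel"
  shows "\<phi> -` E \<in> sets borel"
  using measurable_sets[OF homeomorphism_measurable[OF assms(1)] assms(2)] by simp

lemma bdd_borel_compose:
  assumes "homeomorphism UNIV UNIV \<phi> \<psi>" "bdd_borel f"
  shows "bdd_borel (\<lambda>x. f (\<phi> x))"
proof -
  obtain B where "\<And>x. norm (f x) \<le> B" using assms(2) bdd_borel_bound by blast
  moreover have "(\<lambda>x. f (\<phi> x)) \<in> borel_measurable borel"
    using assms(2) by (intro measurable_compose[OF homeomorphism_measurable[OF assms(1)]]) (simp add: bdd_borel_def)
  ultimately show ?thesis by (intro bdd_borelI)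
qed

lemma integrable_bdd_borel:
  assumes "finite_measure \<rho>" "sets \<rho> = sets borel" "bdd_borel f"
  shows "integrable \<rho> f"
proof -
  interpret finite_measure \<rho> by fact
  obtain B where "\<And>x. norm (f x) \<le> B" using assms(3) by (metis bdd_borel_bound)
  moreover have "f \<in> borel_measurable \<rho>"
    using assms by (simp add: bdd_borel_def cong: measurable_cong_sets)
  ultimately show ?thesis by (intro integrable_const_bound[where B = B]) auto
qed

text \<open>Expresses \<open>\<mu> = h \<rho>\<close>. The base \<open>\<rho>\<close> is left free
  because a sum needs a common base and a push-forward a transported one; \<open>h\<close> is
  bounded, not merely integrable, so that its product with a bounded Borel function is again of that
  class.\<close>

definition radon_density ::
    "'a::t2_space radon_measure \<Rightarrow> 'a measure \<Rightarrow> ('a \<Rightarrow> complex) \<Rightarrow> bool" where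
  "radon_density \<mu> \<rho> h \<longleftrightarrow> finite_measure \<rho> \<and> sets \<rho> = sets borel \<and> bdd_borel h \<and>
     (\<forall>E\<in>sets borel. charge \<mu> E = (LINT x:E|\<rho>. h x))"

text \<open>Domination by \<open>\<rho>\<close> forces the Radon-Nikodym densities of both Jordan
  parts to be at most 1 almost everywhere. After truncation the bounds hold everywhere, and the
  difference of two functions with values in [0, 1] has absolute value at most 1.\<close>

lemma real_density_exists:
  fixes \<sigma> :: "'a::topological_space set \<Rightarrow> real"
  assumes vm: "vector_measure \<sigma>" and \<rho>: "finite_measure \<rho>" "sets \<rho> = sets borel"
    and le: "\<And>E. E \<in> sets borel \<Longrightarrow> total_variation \<sigma> E \<le> emeasure \<rho> E"
  obtains r where "r \<in> borel_measurable borel" "\<And>x. \<bar>r x\<bar> \<le> 1"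
    "\<And>E. E \<in> sets borel \<Longrightarrow> \<sigma> E = (LINT x:E|\<rho>. r x)"
proof -
  interpret finite_measure \<rho> by fact
  have si: "set_integrable \<rho> E g" if "integrable \<rho> g" "E \<in> sets borel" for E and g :: "'a \<Rightarrow> real"
    unfolding set_integrable_def using that \<rho>(2) by (intro integrable_mult_indicator) auto
  have fin: "total_variation \<sigma> UNIV < \<infinity>"
    using le_less_trans[OF le[of UNIV], of \<infinity>] by (simp add: less_top[symmetric])
  \<comment> \<open>Stated for every \<open>\<tau>\<close> with the variation of
    \<open>\<sigma>\<close>, so that it serves both \<open>\<sigma>\<close> and its
    negative.\<close>
  have *: "\<exists>p. p \<in> borel_measurable borel \<and> (\<forall>x. 0 \<le> p x \<and> p x \<le> 1) \<and>
    (\<forall>E\<in>sets borel. measure (positive_part \<tau>) E = (LINT x:E|\<rho>. p x))"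
    if vm: "vector_measure \<tau>" and tv: "total_variation \<tau> = total_variation \<sigma>" for \<tau> :: "'a set \<Rightarrow> real"
  proof -
    have fin': "total_variation \<tau> UNIV < \<infinity>" using fin tv by simp
    have null: "total_variation \<tau> E = 0" if "E \<in> sets borel" "emeasure \<rho> E = 0" for E
      using le[OF that(1)] that(2) tv by simp
    obtain p where p: "integrable \<rho> p" "\<And>x. 0 \<le> p x"
      "\<And>E. E \<in> sets borel \<Longrightarrow> measure (positive_part \<tau>) E = (LINT x:E|\<rho>. p x)"
      using positive_part_density[OF vm fin' \<rho>] null by auto
    \<comment> \<open>This set is null: \<open>p - 1\<close> is positive on it, yet its integral
      there is the mass of the positive part minus the \<open>\<rho>\<close>-mass, which is at most
      0.\<close>
    define A where "A = {x \<in> space \<rho>. 1 < p x}"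
    have [measurable]: "p \<in> borel_measurable \<rho>" using p by auto
    have A[measurable]: "A \<in> sets \<rho>" unfolding A_def by measurable
    then have A': "A \<in> sets borel" using \<rho> by simp
    have "emeasure (positive_part \<tau>) A \<le> emeasure \<rho> A"
      using emeasure_positive_part_le[OF vm fin' A'] le[OF A'] by (simp add: tv)
    then have "measure (positive_part \<tau>) A \<le> measure \<rho> A"
      unfolding measure_def using emeasure_finite[of A] by (intro enn2real_mono) (auto simp: less_top[symmetric])
    moreover have "(LINT x:A|\<rho>. p x - 1) = (LINT x:A|\<rho>. p x) - (LINT x:A|\<rho>. 1)"
      using A' p by (intro set_integral_diff si) auto
    moreover have "(LINT x:A|\<rho>. 1) = measure \<rho> A"
      using A by (simp add: set_lebesgue_integral_def)
    moreover have "(LINT x:A|\<rho>. p x - 1) \<ge> 0"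
      unfolding set_lebesgue_integral_def by (intro integral_nonneg_AE AE_I2) (auto simp: A_def indicator_def)
    ultimately have "(LINT x:A|\<rho>. p x - 1) = 0" using p(3)[OF A'] by simp
    then have "A \<in> null_sets \<rho>"
      using p A by (intro null_if_pos_func_has_zero_int[where f = "\<lambda>x. p x - 1"]) (auto simp: A_def)
    then have "AE x in \<rho>. x \<notin> A" by (rule AE_not_in)
    then have "AE x in \<rho>. p x = min 1 (p x)" by (rule AE_mp) (auto simp: A_def)
    then have "(LINT x:E|\<rho>. p x) = (LINT x:E|\<rho>. min 1 (p x))" if "E \<in> sets borel" for E
      using that \<rho>(2) by (intro set_lebesgue_integral_cong_AE) auto
    moreover have "(\<lambda>x. min 1 (p x)) \<in> borel_measurable borel"
      using \<open>p \<in> borel_measurable \<rho>\<close> \<rho>(2) by (simp cong: measurable_cong_sets)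
    ultimately show ?thesis
      using p by (intro exI[of _ "\<lambda>x. min 1 (p x)"]) auto
  qed
  obtain p where p: "p \<in> borel_measurable borel" "\<And>x. 0 \<le> p x" "\<And>x. p x \<le> 1"
    "\<And>E. E \<in> sets borel \<Longrightarrow> measure (positive_part \<sigma>) E = (LINT x:E|\<rho>. p x)"
    using *[OF vm refl] by blast
  obtain q where q: "q \<in> borel_measurable borel" "\<And>x. 0 \<le> q x" "\<And>x. q x \<le> 1"
    "\<And>E. E \<in> sets borel \<Longrightarrow> measure (positive_part (\<lambda>E. - \<sigma> E)) E = (LINT x:E|\<rho>. q x)"
    using *[OF vector_measure_uminus[OF vm] total_variation_uminus] by blast
  have [measurable]: "p \<in> borel_measurable \<rho>" "q \<in> borel_measurable \<rho>"
    using p(1) q(1) \<rho>(2) by (simp_all cong: measurable_cong_sets)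
  have int: "integrable \<rho> p" "integrable \<rho> q"
    using p(2,3) q(2,3) by (auto intro!: integrable_const_bound[where B = 1])
  show thesis
  proof (rule that)
    show "(\<lambda>x. p x - q x) \<in> borel_measurable borel" using p(1) q(1) by simp
    show "\<bar>p x - q x\<bar> \<le> 1" for x using p(2,3)[of x] q(2,3)[of x] by linarith
    fix E assume E: "E \<in> sets (borel :: 'a measure)"
    have "(LINT x:E|\<rho>. p x - q x) = (LINT x:E|\<rho>. p x) - (LINT x:E|\<rho>. q x)"
      using int E by (intro set_integral_diff si)
    also have "\<dots> = \<sigma> E"
      using measure_positive_part[OF vm fin E]
        measure_positive_part[OF vector_measure_uminus[OF vm] _ E] fin
      unfolding p(4)[OF E, symmetric] q(4)[OF E, symmetric] total_variation_uminus by (simp add: field_simps)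
    finally show "\<sigma> E = (LINT x:E|\<rho>. p x - q x)" by simp
  qed
qed

lemma integral_Complex:
  assumes "integrable \<rho> a" "integrable \<rho> b"
  shows "(LINT x|\<rho>. complex_of_real (a x) + \<i> * complex_of_real (b x))
    = complex_of_real (LINT x|\<rho>. a x) + \<i> * complex_of_real (LINT x|\<rho>. b x)"
  using assms by simp

text \<open>The constant 2 comes from treating real and imaginary parts separately; the optimal
  constant is 1.\<close>

lemma radon_density_exists:
  fixes \<mu> :: "'a::t2_space radon_measure"
  assumes \<rho>: "finite_measure \<rho>" "sets \<rho> = sets borel"
    and le: "\<And>E. E \<in> sets borel \<Longrightarrow> \<bar>\<mu>\<bar>\<^sub>m E \<le> emeasure \<rho> E"
  obtains h where "radon_density \<mu> \<rho> h" "\<And>x. norm (h x) \<le> 2"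
proof -
  interpret finite_measure \<rho> by fact
  obtain r where r: "r \<in> borel_measurable borel" "\<And>x. \<bar>r x\<bar> \<le> 1"
    "\<And>E. E \<in> sets borel \<Longrightarrow> Re (charge \<mu> E) = (LINT x:E|\<rho>. r x)"
  proof (rule real_density_exists[OF _ \<rho>])
    show "vector_measure (\<lambda>E. Re (charge \<mu> E))"
      by (rule vector_measure_bounded_linear[OF vector_measure_charge bounded_linear_Re])
    show "total_variation (\<lambda>E. Re (charge \<mu> E)) E \<le> emeasure \<rho> E" if "E \<in> sets borel" for E
      by (rule order_trans[OF total_variation_norm_mono le[OF that]]) (simp add: abs_Re_le_cmod)
  qed blast
  obtain s where s: "s \<in> borel_measurable borel" "\<And>x. \<bar>s x\<bar> \<le> 1"
    "\<And>E. E \<in> sets borel \<Longrightarrow> Im (charge \<mu> E) = (LINT x:E|\<rho>. s x)"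
  proof (rule real_density_exists[OF _ \<rho>])
    show "vector_measure (\<lambda>E. Im (charge \<mu> E))"
      by (rule vector_measure_bounded_linear[OF vector_measure_charge bounded_linear_Im])
    show "total_variation (\<lambda>E. Im (charge \<mu> E)) E \<le> emeasure \<rho> E" if "E \<in> sets borel" for E
      by (rule order_trans[OF total_variation_norm_mono le[OF that]]) (simp add: abs_Im_le_cmod)
  qed blast
  let ?h = "\<lambda>x. complex_of_real (r x) + \<i> * complex_of_real (s x)"
  have 2: "norm (?h x) \<le> 2" for x
    using norm_triangle_ineq[of "complex_of_real (r x)" "\<i> * complex_of_real (s x)"] r(2)[of x] s(2)[of x]
    by (simp add: norm_mult)
  have "bdd_borel ?h"
    using 2 r(1) s(1) by (intro bdd_borelI) auto
  moreover have "charge \<mu> E = (LINT x:E|\<rho>. ?h x)" if E: "E \<in> sets borel" for E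
  proof -
    have *: "integrable \<rho> (\<lambda>x. indicator E x * g x)" if g: "g \<in> borel_measurable borel" "\<And>x. \<bar>g x\<bar> \<le> 1"
      for g :: "'a \<Rightarrow> real"
    proof (rule integrable_const_bound[where B = 1])
      show "(\<lambda>x. indicator E x * g x) \<in> borel_measurable \<rho>"
        using g(1) E \<rho>(2) by (simp cong: measurable_cong_sets)
      show "AE x in \<rho>. norm (indicator E x * g x) \<le> 1" using g(2) by (simp add: indicator_def)
    qed
    have "(LINT x:E|\<rho>. ?h x) = (LINT x|\<rho>. complex_of_real (indicator E x * r x) + \<i> * complex_of_real (indicator E x * s x))"
      unfolding set_lebesgue_integral_def
      by (intro Bochner_Integration.integral_cong) (auto simp: scaleR_conv_of_real algebra_simps)
    also have "\<dots> = charge \<mu> E"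
      using * r s E by (subst integral_Complex) (auto simp: complex_eq_iff set_lebesgue_integral_def)
    finally show ?thesis by simp
  qed
  ultimately show thesis using that[of ?h] 2 \<rho> by (auto simp: radon_density_def)
qed

text \<open>Applying \<open>signed_integral_density\<close> to the real and imaginary parts of
  \<open>h\<close> collapses the four positive measures of the definition into one Bochner integral.
  The left side depends on \<open>\<mu>\<close> alone, so \<open>\<rho>\<close> and \<open>h\<close>
  may be chosen at convenience.\<close>

lemma radon_integral_density:
  fixes \<mu> :: "'a::t2_space radon_measure"
  assumes h: "radon_density \<mu> \<rho> h" and f: "bdd_borel f"
  shows "radon_integral \<mu> f = (LINT x|\<rho>. h x * f x)"
proof -
  have \<rho>: "finite_measure \<rho>" "sets \<rho> = sets borel" and hb: "bdd_borel h"
    and ch: "\<And>E. E \<in> sets borel \<Longrightarrow> charge \<mu> E = (LINT x:E|\<rho>. h x)"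
    using h by (auto simp: radon_density_def)
  note int = integrable_bdd_borel[OF \<rho>]
  have ih: "integrable \<rho> h" using int hb .
  have ii: "integrable \<rho> (\<lambda>x. indicator E x *\<^sub>R h x)" if "E \<in> sets borel" for E
    using that \<rho> ih by (intro integrable_mult_indicator) auto
  have bRe: "bdd_borel (\<lambda>x. complex_of_real (Re (h x)))" "bdd_borel (\<lambda>x. complex_of_real (Im (h x)))"
    using hb abs_Re_le_cmod abs_Im_le_cmod order_trans unfolding bdd_borel_def bounded_iff by auto (blast | fastforce)+
  have Re: "signed_integral (\<lambda>E. Re (charge \<mu> E)) f = (LINT x|\<rho>. Re (h x) *\<^sub>R f x)"
  proof (rule signed_integral_density[OF \<rho>])
    show "integrable \<rho> (\<lambda>x. Re (h x))" using ih by simp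
    show "Re (charge \<mu> E) = (LINT x:E|\<rho>. Re (h x))" if "E \<in> sets borel" for E
      using integral_Re[OF ii[OF that]] by (simp add: ch[OF that] set_lebesgue_integral_def)
  qed (use f in \<open>auto simp: bdd_borel_def\<close>)
  have Im: "signed_integral (\<lambda>E. Im (charge \<mu> E)) f = (LINT x|\<rho>. Im (h x) *\<^sub>R f x)"
  proof (rule signed_integral_density[OF \<rho>])
    show "integrable \<rho> (\<lambda>x. Im (h x))" using ih by simp
    show "Im (charge \<mu> E) = (LINT x:E|\<rho>. Im (h x))" if "E \<in> sets borel" for E
      using integral_Im[OF ii[OF that]] by (simp add: ch[OF that] set_lebesgue_integral_def)
  qed (use f in \<open>auto simp: bdd_borel_def\<close>)
  have split: "(LINT x|\<rho>. h x * f x) = (LINT x|\<rho>. Re (h x) *\<^sub>R f x + \<i> * (Im (h x) *\<^sub>R f x))"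
    by (intro Bochner_Integration.integral_cong refl)
      (metis (no_types, lifting) complex_eq distrib_right mult.assoc scaleR_conv_of_real)
  have int2: "integrable \<rho> (\<lambda>x. Re (h x) *\<^sub>R f x)" "integrable \<rho> (\<lambda>x. Im (h x) *\<^sub>R f x)"
    unfolding scaleR_conv_of_real by (intro int bdd_borel_mult bRe f)+
  have lin: "(LINT x|\<rho>. a x + \<i> * b x) = (LINT x|\<rho>. a x) + \<i> * (LINT x|\<rho>. b x)"
    if "integrable \<rho> a" "integrable \<rho> b" for a b :: "'a \<Rightarrow> complex"
    using that by simp
  show ?thesis
    unfolding radon_integral_def Re Im split by (rule lin[OF int2, symmetric])
qed

text \<open>The variation dominates itself and can serve as the base measure; estimates through the
  bound 2 on \<open>h\<close> are then in terms of \<open>|\<mu>|\<close>.\<close>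

lemma radon_density_variation:
  fixes \<mu> :: "'a::t2_space radon_measure"
  obtains h where "radon_density \<mu> (variation_measure (charge \<mu>)) h" "\<And>x. norm (h x) \<le> 2"
proof (rule radon_density_exists)
  show "finite_measure (variation_measure (charge \<mu>))"
    by (rule finite_measure_variation[OF vector_measure_charge abs_measure_finite])
  show "sets (variation_measure (charge \<mu>)) = sets borel" by simp
  show "\<bar>\<mu>\<bar>\<^sub>m E \<le> emeasure (variation_measure (charge \<mu>)) E" if "E \<in> sets borel" for E
    by (simp add: emeasure_variation_measure[OF vector_measure_charge that])
qed (rule that)

text \<open>Recovers a measure from its integral, so identities between measures reduce to
  identities between integrals of bounded Borel functions.\<close>

lemma radon_integral_indicator:
  assumes "E \<in> sets borel"
  shows "radon_integral \<mu> (indicator E) = charge \<mu> E"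
proof -
  obtain h where h: "radon_density \<mu> (variation_measure (charge \<mu>)) h"
    by (rule radon_density_variation)
  show ?thesis
    using h assms unfolding radon_integral_density[OF h bdd_borel_indicator[OF assms]]
    by (simp add: radon_density_def set_lebesgue_integral_def)
      (auto intro!: Bochner_Integration.integral_cong simp: indicator_def)
qed

section \<open>Linearity of the integral in the function and in the measure\<close>

lemma radon_integral_add_right:
  assumes "bdd_borel f" "bdd_borel g"
  shows "radon_integral \<mu> (\<lambda>x. f x + g x) = radon_integral \<mu> f + radon_integral \<mu> g"
proof -
  obtain h where h: "radon_density \<mu> (variation_measure (charge \<mu>)) h"
    by (rule radon_density_variation)
  then have "integrable (variation_measure (charge \<mu>)) (\<lambda>x. h x * k x)" if "bdd_borel k" for k
    using that by (intro integrable_bdd_borel bdd_borel_mult) (auto simp: radon_density_def)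
  then show ?thesis
    using assms by (simp add: radon_integral_density[OF h] bdd_borel_add distrib_left)
qed

lemma radon_integral_scaleR_left:
  assumes "bdd_borel f"
  shows "radon_integral (c *\<^sub>R \<mu>) f = c *\<^sub>R radon_integral \<mu> f"
proof -
  obtain h where h: "radon_density \<mu> (variation_measure (charge \<mu>)) h"
    by (rule radon_density_variation)
  then have "radon_density (c *\<^sub>R \<mu>) (variation_measure (charge \<mu>)) (\<lambda>x. complex_of_real c * h x)"
    by (auto simp: radon_density_def scaleR_radon_measure.rep_eq scaleR_conv_of_real[where 'a=complex]
       intro!: bdd_borel_mult[OF bdd_borel_const])
  then show ?thesis
    using assms by (simp add: radon_integral_density[OF h] radon_integral_density mult.assoc scaleR_conv_of_real)
qed

text \<open>The variation of the pair \<open>(\<mu>, \<nu>)\<close>, as a vector measure, dominates both \<open>|\<mu>|\<close> and \<open>|\<nu>|\<close>.\<close>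

lemma radon_integral_add_left:
  fixes \<mu> \<nu> :: "'a::t2_space radon_measure"
  assumes f: "bdd_borel f"
  shows "radon_integral (\<mu> + \<nu>) f = radon_integral \<mu> f + radon_integral \<nu> f"
proof -
  let ?\<xi> = "\<lambda>E. (charge \<mu> E, charge \<nu> E)"
  let ?\<rho> = "variation_measure ?\<xi>"
  have vm: "vector_measure ?\<xi>" by (intro vector_measure_Pair vector_measure_charge)
  have "total_variation ?\<xi> E \<le> \<bar>\<mu>\<bar>\<^sub>m E + \<bar>\<nu>\<bar>\<^sub>m E" for E
  proof -
    have "total_variation ?\<xi> E = total_variation (\<lambda>E. (charge \<mu> E, 0 :: complex) + (0 :: complex, charge \<nu> E)) E"
      by simp
    also have "\<dots> \<le> total_variation (\<lambda>E. (charge \<mu> E, 0 :: complex)) E + total_variation (\<lambda>E. (0 :: complex, charge \<nu> E)) E"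
      by (rule total_variation_add)
    also have "\<dots> = \<bar>\<mu>\<bar>\<^sub>m E + \<bar>\<nu>\<bar>\<^sub>m E"
      using total_variation_cong[of "\<lambda>E. (charge \<mu> E, 0 :: complex)" "charge \<mu>"]
        total_variation_cong[of "\<lambda>E. (0 :: complex, charge \<nu> E)" "charge \<nu>"] by (simp add: norm_Pair)
    finally show ?thesis .
  qed
  from this[of UNIV] have "total_variation ?\<xi> UNIV < \<infinity>"
    using abs_measure_finite[of \<mu>] abs_measure_finite[of \<nu>] by (auto intro: le_less_trans)
  then have \<rho>: "finite_measure ?\<rho>" "sets ?\<rho> = sets borel"
    using finite_measure_variation[OF vm] by simp_all
  have "\<bar>\<mu>\<bar>\<^sub>m E \<le> emeasure ?\<rho> E" "\<bar>\<nu>\<bar>\<^sub>m E \<le> emeasure ?\<rho> E" if "E \<in> sets borel" for E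
    unfolding emeasure_variation_measure[OF vm that]
    by (intro total_variation_norm_mono, simp add: norm_Pair real_sqrt_sum_squares_ge1 real_sqrt_sum_squares_ge2)+
  then obtain h k where h: "radon_density \<mu> ?\<rho> h" and k: "radon_density \<nu> ?\<rho> k"
    using radon_density_exists[OF \<rho>] by metis
  have int: "integrable ?\<rho> h" "integrable ?\<rho> k"
    using h k integrable_bdd_borel[OF \<rho>] by (auto simp: radon_density_def)
  have "set_integrable ?\<rho> E h" "set_integrable ?\<rho> E k" if "E \<in> sets borel" for E
    unfolding set_integrable_def using that int by (auto intro: integrable_mult_indicator)
  then have hk: "radon_density (\<mu> + \<nu>) ?\<rho> (\<lambda>x. h x + k x)"
    using h k by (auto simp: radon_density_def plus_radon_measure.rep_eq bdd_borel_add set_integral_add)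
  have "integrable ?\<rho> (\<lambda>x. h x * f x)" "integrable ?\<rho> (\<lambda>x. k x * f x)"
    using h k f integrable_bdd_borel[OF \<rho>] by (auto simp: radon_density_def bdd_borel_mult)
  then show ?thesis
    by (simp add: radon_integral_density[OF h f] radon_integral_density[OF k f]
      radon_integral_density[OF hk f] distrib_right)
qed

section \<open>Weighted push-forward\<close>

text \<open>This is the image under \<open>\<phi>\<close> of the measure \<open>g \<mu>\<close>. The
  adjoints of weighted composition operators, their powers and the restrictions to Borel sets all
  have this form. The value 0 off the Borel sets matches the normalisation in
  \<open>complex_radon\<close>.\<close>

definition push ::
    "('a \<Rightarrow> 'a) \<Rightarrow> ('a \<Rightarrow> complex) \<Rightarrow> 'a::t2_space radon_measure \<Rightarrow> 'a radon_measure" where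
  "push \<phi> g \<mu> = Abs_radon_measure
     (\<lambda>E. if E \<in> sets borel then radon_integral \<mu> (\<lambda>x. indicator (\<phi> -` E) x * g x) else 0)"

text \<open>Write \<open>\<mu>\<close> as a density of norm at most 2 against
  \<open>|\<mu>|\<close>. Transporting \<open>|\<mu>|\<close> along \<open>\<phi>\<close>, and the
  density times \<open>g\<close> back along \<open>\<psi>\<close>, represents the push-forward. As
  \<open>g\<close> vanishes off \<open>B\<close> and is bounded by \<open>C\<close>, only the part
  of \<open>|\<mu>|\<close> on \<open>B\<close> counts; the factor 2 is the bound on the density of
  \<open>\<mu>\<close>.\<close>

lemma push_density:
  fixes \<mu> :: "'a::t2_space radon_measure"
  assumes \<phi>: "homeomorphism UNIV UNIV \<phi> \<psi>" and g: "bdd_borel g"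
  shows "\<exists>\<rho> h. finite_measure \<rho> \<and> sets \<rho> = sets borel \<and> bdd_borel h \<and>
    (\<forall>f. bdd_borel f \<longrightarrow> radon_integral \<mu> (\<lambda>x. f (\<phi> x) * g x) = (LINT y|\<rho>. h y * f y)) \<and>
    (\<forall>C B E. B \<in> sets borel \<longrightarrow> E \<in> sets borel \<longrightarrow>
      (\<forall>x. ennreal (norm (g x)) \<le> C * indicator B x) \<longrightarrow>
      (\<integral>\<^sup>+y\<in>E. ennreal (norm (h y)) \<partial>\<rho>) \<le> 2 * C * \<bar>\<mu>\<bar>\<^sub>m (\<phi> -` E \<inter> B))"
proof -
  let ?\<rho> = "variation_measure (charge \<mu>)"
  obtain h where h: "radon_density \<mu> ?\<rho> h" and h2: "\<And>x. norm (h x) \<le> 2"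
    by (rule radon_density_variation) blast
  then interpret \<rho>: finite_measure ?\<rho> by (simp add: radon_density_def)
  have hb: "bdd_borel h" using h by (simp add: radon_density_def)
  let ?\<rho>' = "distr ?\<rho> borel \<phi>"
  let ?h = "\<lambda>y. h (\<psi> y) * g (\<psi> y)"
  have \<phi>m: "\<phi> \<in> measurable ?\<rho> borel"
    using homeomorphism_measurable[OF \<phi>] by (simp cong: measurable_cong_sets)
  have \<psi>\<phi>: "\<psi> (\<phi> x) = x" for x using \<phi> by (simp add: homeomorphism_def)
  have h': "bdd_borel ?h"
    using bdd_borel_compose[OF homeomorphism_symD[OF \<phi>]] hb g by (intro bdd_borel_mult) blast+
  have "radon_integral \<mu> (\<lambda>x. f (\<phi> x) * g x) = (LINT y|?\<rho>'. ?h y * f y)" if f: "bdd_borel f" for f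
  proof -
    have "radon_integral \<mu> (\<lambda>x. f (\<phi> x) * g x) = (LINT x|?\<rho>. h x * (f (\<phi> x) * g x))"
      by (intro radon_integral_density[OF h] bdd_borel_mult bdd_borel_compose[OF \<phi>] f g)
    also have "\<dots> = (LINT x|?\<rho>. ?h (\<phi> x) * f (\<phi> x))" by (simp add: \<psi>\<phi> mult_ac)
    also have "\<dots> = (LINT y|?\<rho>'. ?h y * f y)"
      using bdd_borel_mult[OF h' f] by (intro integral_distr[OF \<phi>m, symmetric]) (simp add: bdd_borel_def)
    finally show ?thesis .
  qed
  moreover have "(\<integral>\<^sup>+y\<in>E. ennreal (norm (?h y)) \<partial>?\<rho>') \<le> 2 * C * \<bar>\<mu>\<bar>\<^sub>m (\<phi> -` E \<inter> B)"
    if B: "B \<in> sets borel" and E: "E \<in> sets borel" and C: "\<And>x. ennreal (norm (g x)) \<le> C * indicator B x" for C B E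
  proof -
    have [measurable]: "?h \<in> borel_measurable borel" "E \<in> sets borel"
      using h' E by (auto simp: bdd_borel_def)
    have "(\<lambda>y. ennreal (norm (?h y)) * indicator E y) \<in> borel_measurable borel" by measurable
    then have "(\<integral>\<^sup>+y\<in>E. ennreal (norm (?h y)) \<partial>?\<rho>') = (\<integral>\<^sup>+x. ennreal (norm (?h (\<phi> x))) * indicator E (\<phi> x) \<partial>?\<rho>)"
      by (intro nn_integral_distr[OF \<phi>m]) simp
    also have "\<dots> \<le> (\<integral>\<^sup>+x. (2 * C) * indicator (\<phi> -` E \<inter> B) x \<partial>?\<rho>)"
    proof (intro nn_integral_mono)
      fix x
      have "ennreal (norm (h x * g x)) = ennreal (norm (h x)) * ennreal (norm (g x))"
        by (simp add: norm_mult ennreal_mult')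
      also have "\<dots> \<le> ennreal 2 * (C * indicator B x)"
        by (intro mult_mono C ennreal_leI h2) auto
      finally show "ennreal (norm (?h (\<phi> x))) * indicator E (\<phi> x) \<le> (2 * C) * indicator (\<phi> -` E \<inter> B) x"
        by (auto simp: \<psi>\<phi> mult.assoc split: split_indicator)
    qed
    also have "\<dots> = 2 * C * \<bar>\<mu>\<bar>\<^sub>m (\<phi> -` E \<inter> B)"
      using homeomorphism_vimage[OF \<phi> E] B
      by (subst nn_integral_cmult_indicator) (auto simp: emeasure_variation_measure vector_measure_charge)
    finally show ?thesis .
  qed
  ultimately show ?thesis
    using \<rho>.finite_measure_distr[OF \<phi>m] h' by (intro exI[of _ ?\<rho>'] exI[of _ ?h]) auto
qed

text \<open>The three facts are proved together because each first needs the set function to be a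
  complex Radon measure. Its variation on \<open>E\<close> is at most a constant times
  \<open>|\<mu>|\<close> on the preimage of \<open>E\<close>, and the homeomorphism carries compact
  and open approximations of the preimage to approximations of \<open>E\<close>; this gives
  regularity.\<close>

lemma push_props:
  fixes \<mu> :: "'a::t2_space radon_measure"
  assumes \<phi>: "homeomorphism UNIV UNIV \<phi> \<psi>" and g: "bdd_borel g"
  shows charge_push: "E \<in> sets borel \<Longrightarrow> charge (push \<phi> g \<mu>) E = radon_integral \<mu> (\<lambda>x. indicator (\<phi> -` E) x * g x)"
    and radon_integral_push: "bdd_borel f \<Longrightarrow> radon_integral (push \<phi> g \<mu>) f = radon_integral \<mu> (\<lambda>x. f (\<phi> x) * g x)"
    and abs_push_le: "B \<in> sets borel \<Longrightarrow> E \<in> sets borel \<Longrightarrow>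
      (\<And>x. ennreal (norm (g x)) \<le> C * indicator B x) \<Longrightarrow>
      \<bar>push \<phi> g \<mu>\<bar>\<^sub>m E \<le> 2 * C * \<bar>\<mu>\<bar>\<^sub>m (\<phi> -` E \<inter> B)"
proof -
  define \<nu> where "\<nu> E = (if E \<in> sets borel then radon_integral \<mu> (\<lambda>x. indicator (\<phi> -` E) x * g x) else 0)" for E
  obtain \<rho> h where \<rho>: "finite_measure \<rho>" "sets \<rho> = sets borel" and h: "bdd_borel h"
    and int: "\<And>f. bdd_borel f \<Longrightarrow> radon_integral \<mu> (\<lambda>x. f (\<phi> x) * g x) = (LINT y|\<rho>. h y * f y)"
    and bound: "\<And>C B E. B \<in> sets borel \<Longrightarrow> E \<in> sets borel \<Longrightarrow>
      (\<forall>x. ennreal (norm (g x)) \<le> C * indicator B x) \<Longrightarrow>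
      (\<integral>\<^sup>+y\<in>E. ennreal (norm (h y)) \<partial>\<rho>) \<le> 2 * C * \<bar>\<mu>\<bar>\<^sub>m (\<phi> -` E \<inter> B)"
    using push_density[OF assms, of \<mu>] by blast
  have ih: "integrable \<rho> h" by (rule integrable_bdd_borel[OF \<rho> h])
  have \<nu>: "\<nu> E = (LINT x:E|\<rho>. h x)" if E: "E \<in> sets borel" for E
  proof -
    have "\<nu> E = (LINT y|\<rho>. h y * indicator E y)"
      using E int[OF bdd_borel_indicator[OF E]] by (simp add: \<nu>_def indicator_vimage)
    then show ?thesis by (simp add: set_lebesgue_integral_def scaleR_conv_of_real mult.commute of_real_indicator)
  qed
  have vm: "vector_measure \<nu>" by (rule vector_measure_set_integral[OF \<rho>(2) ih \<nu>])
  have tv: "total_variation \<nu> E \<le> 2 * C * \<bar>\<mu>\<bar>\<^sub>m (\<phi> -` E \<inter> B)"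
    if "B \<in> sets borel" "E \<in> sets borel" "\<And>x. ennreal (norm (g x)) \<le> C * indicator B x" for B E C
    by (rule order_trans[OF total_variation_set_integral_le[OF \<rho>(2) ih that(2) \<nu>] bound]) (use that in auto)
  \<comment> \<open>A global bound for \<open>g\<close> allows \<open>B = UNIV\<close>; the level
    \<open>e / (2 * c)\<close> chosen below undoes the resulting factor.\<close>
  obtain c where c: "c > 0" "\<And>x. norm (g x) \<le> c" using g by (metis bdd_borel_bound)
  have tv': "total_variation \<nu> E \<le> ennreal (2 * c) * \<bar>\<mu>\<bar>\<^sub>m (\<phi> -` E)" if "E \<in> sets borel" for E
    using tv[of UNIV E "ennreal c"] that c by (simp add: ennreal_leI ennreal_mult)
  have "complex_radon \<nu>"
    unfolding complex_radon_def
  proof (intro conjI allI impI)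
    show "total_variation \<nu> UNIV < \<infinity>"
      using le_less_trans[OF tv'[of UNIV], of \<infinity>] abs_measure_finite[of \<mu>]
      by (simp add: ennreal_mult_less_top)
    show "regular_on_borel (total_variation \<nu>)"
    proof (rule regular_on_borelI[OF vm])
      fix E :: "'a set" and e :: real assume E: "E \<in> sets borel" and e: "e > 0"
      have "e / (2 * c) > 0" using e c by simp
      then obtain K V where KV: "compact K" "open V" "K \<subseteq> \<phi> -` E" "\<phi> -` E \<subseteq> V"
        "\<bar>\<mu>\<bar>\<^sub>m (V - K) \<le> ennreal (e / (2 * c))"
        using regular_approx[OF complex_radon_charge homeomorphism_vimage[OF \<phi> E]] by metis
      have inv: "\<phi> (\<psi> y) = y" "\<psi> (\<phi> x) = x" for x y using \<phi> by (simp_all add: homeomorphism_def)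
      \<comment> \<open>Images under \<open>\<phi>\<close> are preimages under
        \<open>\<psi>\<close>, so openness of the image of \<open>V\<close> follows from continuity
        of \<open>\<psi>\<close>.\<close>
      have im: "\<phi> ` S = \<psi> -` S" for S using inv by (auto simp: image_iff) metis
      have "compact (\<phi> ` K)"
        using KV(1) \<phi> by (intro compact_continuous_image) (auto simp: homeomorphism_def intro: continuous_on_subset)
      moreover have "open (\<phi> ` V)"
        unfolding im using KV(2) \<phi> by (intro open_vimage) (auto simp: homeomorphism_def)
      moreover have "\<phi> ` K \<subseteq> E" "E \<subseteq> \<phi> ` V" using KV(3) subsetD[OF KV(4)] by (auto simp: im inv)
      moreover have "total_variation \<nu> (\<phi> ` V - \<phi> ` K) \<le> ennreal e"
      proof -
        have "total_variation \<nu> (\<phi> ` V - \<phi> ` K) \<le> ennreal (2 * c) * \<bar>\<mu>\<bar>\<^sub>m (\<phi> -` (\<phi> ` V - \<phi> ` K))"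
          using \<open>open (\<phi> ` V)\<close> \<open>compact (\<phi> ` K)\<close> by (intro tv' sets.Diff) (simp_all add: borel_open borel_compact)
        also have "\<phi> -` (\<phi> ` V - \<phi> ` K) = V - K" by (auto simp: im inv)
        also have "ennreal (2 * c) * \<bar>\<mu>\<bar>\<^sub>m (V - K) \<le> ennreal (2 * c) * ennreal (e / (2 * c))"
          by (intro mult_left_mono KV) auto
        also have "\<dots> = ennreal e" using c e by (subst ennreal_mult[symmetric]) auto
        finally show ?thesis .
      qed
      ultimately show "\<exists>K V. compact K \<and> open V \<and> K \<subseteq> E \<and> E \<subseteq> V \<and> total_variation \<nu> (V - K) \<le> ennreal e"
        by blast
    qed
  qed (auto simp: vm \<nu>_def)
  then have ch: "charge (push \<phi> g \<mu>) = \<nu>"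
    unfolding push_def \<nu>_def[abs_def, symmetric] by (subst Abs_radon_measure_inverse) auto
  show "charge (push \<phi> g \<mu>) E = radon_integral \<mu> (\<lambda>x. indicator (\<phi> -` E) x * g x)" if "E \<in> sets borel"
    using that by (simp add: ch \<nu>_def)
  have "radon_density (push \<phi> g \<mu>) \<rho> h" using \<rho> h \<nu> by (simp add: radon_density_def ch)
  then show "radon_integral (push \<phi> g \<mu>) f = radon_integral \<mu> (\<lambda>x. f (\<phi> x) * g x)" if "bdd_borel f"
    using that by (simp add: int radon_integral_density)
  show "\<bar>push \<phi> g \<mu>\<bar>\<^sub>m E \<le> 2 * C * \<bar>\<mu>\<bar>\<^sub>m (\<phi> -` E \<inter> B)"
    if "B \<in> sets borel" "E \<in> sets borel" "\<And>x. ennreal (norm (g x)) \<le> C * indicator B x"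
    using tv[OF that] by (simp add: ch)
qed

section \<open>Composition and linearity of weighted push-forwards\<close>

lemma radon_measure_eqI:
  assumes "\<And>E. E \<in> sets borel \<Longrightarrow> charge \<mu> E = charge \<nu> E"
  shows "\<mu> = \<nu>"
proof -
  have "charge \<mu> E = charge \<nu> E" for E
    using assms complex_radon_charge[of \<mu>] complex_radon_charge[of \<nu>]
    by (cases "E \<in> sets borel") (auto simp: complex_radon_def)
  then show ?thesis by (simp add: charge_inject[symmetric] fun_eq_iff)
qed

lemma bdd_borel_vimage:
  assumes "homeomorphism UNIV UNIV \<phi> \<psi>" "bdd_borel g" "E \<in> sets borel"
  shows "bdd_borel (\<lambda>x. indicator (\<phi> -` E) x * g x)"
  by (intro bdd_borel_mult bdd_borel_indicator homeomorphism_vimage[OF assms(1)] assms)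

lemma homeomorphism_comp:
  "homeomorphism UNIV UNIV \<phi> \<phi>' \<Longrightarrow> homeomorphism UNIV UNIV \<psi> \<psi>' \<Longrightarrow>
    homeomorphism UNIV UNIV (\<lambda>x. \<phi> (\<psi> x)) (\<lambda>x. \<psi>' (\<phi>' x))"
  using homeomorphism_compose[of UNIV UNIV \<psi> \<psi>' UNIV \<phi> \<phi>'] by (simp add: o_def)

text \<open>The inner push-forward is integrated against a bounded Borel function by
  \<open>radon_integral_push\<close>. Points have already moved by \<open>\<psi>\<close> when the
  outer weight acts, so \<open>g\<close> is evaluated at \<open>\<psi> x\<close>.\<close>

lemma push_push:
  assumes \<phi>: "homeomorphism UNIV UNIV \<phi> \<phi>'" and \<psi>: "homeomorphism UNIV UNIV \<psi> \<psi>'"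
    and g: "bdd_borel g" and k: "bdd_borel k"
  shows "push \<phi> g (push \<psi> k \<mu>) = push (\<lambda>x. \<phi> (\<psi> x)) (\<lambda>x. g (\<psi> x) * k x) \<mu>"
proof (rule radon_measure_eqI)
  fix E :: "'a set" assume E: "E \<in> sets borel"
  have "charge (push \<phi> g (push \<psi> k \<mu>)) E = radon_integral \<mu> (\<lambda>x. (indicator (\<phi> -` E) (\<psi> x) * g (\<psi> x)) * k x)"
    by (simp add: charge_push[OF \<phi> g E] radon_integral_push[OF \<psi> k bdd_borel_vimage[OF \<phi> g E]])
  also have "\<dots> = charge (push (\<lambda>x. \<phi> (\<psi> x)) (\<lambda>x. g (\<psi> x) * k x) \<mu>) E"
    by (subst charge_push[OF homeomorphism_comp[OF \<phi> \<psi>] bdd_borel_mult[OF bdd_borel_compose[OF \<psi> g] k] E])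
      (simp add: indicator_def mult.assoc)
  finally show "charge (push \<phi> g (push \<psi> k \<mu>)) E = charge (push (\<lambda>x. \<phi> (\<psi> x)) (\<lambda>x. g (\<psi> x) * k x) \<mu>) E" .
qed

lemma homeomorphism_id: "homeomorphism UNIV UNIV (\<lambda>x. x) (\<lambda>x. x)"
  by (simp add: homeomorphism_def)

lemma push_id: "push (\<lambda>x. x) (\<lambda>x. 1) \<mu> = \<mu>"
  by (rule radon_measure_eqI)
    (simp add: charge_push[OF homeomorphism_id bdd_borel_const] radon_integral_indicator vimage_def eta_contract_eq)

lemma push_add:
  assumes "homeomorphism UNIV UNIV \<phi> \<psi>" "bdd_borel g"
  shows "push \<phi> g (\<mu> + \<nu>) = push \<phi> g \<mu> + push \<phi> g \<nu>"
  by (rule radon_measure_eqI)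
    (simp add: plus_radon_measure.rep_eq charge_push[OF assms] radon_integral_add_left bdd_borel_vimage[OF assms])

lemma push_scaleR:
  assumes "homeomorphism UNIV UNIV \<phi> \<psi>" "bdd_borel g"
  shows "push \<phi> g (c *\<^sub>R \<mu>) = c *\<^sub>R push \<phi> g \<mu>"
  by (rule radon_measure_eqI)
    (simp add: scaleR_radon_measure.rep_eq charge_push[OF assms] radon_integral_scaleR_left bdd_borel_vimage[OF assms])

lemma push_add_weight:
  assumes \<phi>: "homeomorphism UNIV UNIV \<phi> \<psi>" and g: "bdd_borel g" and k: "bdd_borel k"
  shows "push \<phi> (\<lambda>x. g x + k x) \<mu> = push \<phi> g \<mu> + push \<phi> k \<mu>"
  by (rule radon_measure_eqI)
    (simp add: plus_radon_measure.rep_eq charge_push[OF \<phi>] g k bdd_borel_add distrib_left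
      radon_integral_add_right bdd_borel_vimage[OF \<phi>])

lemma ennreal_norm_eq: "ennreal (norm \<mu>) = \<bar>\<mu>\<bar>\<^sub>m UNIV"
  using abs_measure_finite[of \<mu>] by (simp add: norm_radon_measure_def ennreal_enn2real_if)

lemma norm_push_le:
  assumes "homeomorphism UNIV UNIV \<phi> \<psi>" "bdd_borel g" "B \<in> sets borel"
    and "\<And>x. ennreal (norm (g x)) \<le> C * indicator B x"
  shows "ennreal (norm (push \<phi> g \<mu>)) \<le> 2 * C * \<bar>\<mu>\<bar>\<^sub>m B"
  using abs_push_le[OF assms(1-3) _ assms(4), of UNIV] by (simp add: ennreal_norm_eq)

section \<open>Uniqueness of adjoints\<close>

text \<open>The integral of \<open>f\<close> is the total mass of the measure
  \<open>f \<mu>\<close>, a push-forward along the identity, whose variation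
  \<open>abs_push_le\<close> controls.\<close>

lemma norm_radon_integral_le:
  assumes f: "bdd_borel f" and B: "B \<in> sets borel"
    and C: "\<And>x. ennreal (norm (f x)) \<le> C * indicator B x"
  shows "ennreal (norm (radon_integral \<mu> f)) \<le> 2 * C * \<bar>\<mu>\<bar>\<^sub>m B"
proof -
  let ?\<nu> = "push (\<lambda>x. x) f \<mu>"
  have "radon_integral \<mu> f = charge ?\<nu> UNIV"
    by (subst charge_push[OF homeomorphism_id f]) simp_all
  then have "ennreal (norm (radon_integral \<mu> f)) \<le> \<bar>?\<nu>\<bar>\<^sub>m UNIV"
    using norm_le_total_variation[OF vector_measure_charge, of UNIV ?\<nu>] by simp
  also have "\<dots> \<le> 2 * C * \<bar>\<mu>\<bar>\<^sub>m B"
    using abs_push_le[OF homeomorphism_id f B _ C, of UNIV \<mu>] by simp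
  finally show ?thesis .
qed

text \<open>Level 1 in the definition of \<open>C0\<close> bounds \<open>f\<close> off a compact
  set, and on that set the image is compact.\<close>

lemma C0_bdd_borel:
  assumes "f \<in> C0" shows "bdd_borel f"
proof -
  have cont: "continuous_on UNIV f" using assms by (simp add: C0_def)
  obtain K where K: "compact K" "\<And>x. x \<notin> K \<Longrightarrow> norm (f x) < 1"
    using assms zero_less_one[where 'a=real] unfolding C0_def by blast
  have "compact (f ` K)"
    by (intro compact_continuous_image continuous_on_subset[OF cont] K) auto
  then obtain b where b: "\<And>x. x \<in> K \<Longrightarrow> norm (f x) \<le> b"
    using compact_imp_bounded by (force simp: bounded_iff)
  show ?thesis
  proof (rule bdd_borelI)
    show "f \<in> borel_measurable borel" using cont by (rule borel_measurable_continuous_onI)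
    show "norm (f x) \<le> max b 1" for x
      using b[of x] K(2)[of x] by (cases "x \<in> K") (auto simp: max_def)
  qed
qed

text \<open>The compact set is separated from the complement of \<open>U \<inter> V\<close>, where
  \<open>U\<close> lies inside a compact \<open>L\<close>. The Urysohn function then vanishes off
  \<open>L\<close>, which places it in \<open>C0\<close>.\<close>

lemma Urysohn_C0:
  fixes K V :: "'a::t2_space set"
  assumes lc: "locally_compact_space (euclidean :: 'a topology)"
    and K: "compact K" and V: "open V" "K \<subseteq> V"
  obtains f :: "'a \<Rightarrow> real" where "(\<lambda>x. complex_of_real (f x)) \<in> C0"
    "\<And>x. 0 \<le> f x" "\<And>x. f x \<le> 1" "\<And>x. x \<in> K \<Longrightarrow> f x = 1" "\<And>x. x \<notin> V \<Longrightarrow> f x = 0"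
proof -
  have H: "Hausdorff_space (euclidean :: 'a topology)"
    unfolding Hausdorff_space_def disjnt_def by (simp add: separation_t2)
  have cr: "completely_regular_space (euclidean :: 'a topology)"
    using locally_compact_regular_imp_completely_regular_space[OF lc] H by blast
  obtain U L where U: "open U" "K \<subseteq> U" "U \<subseteq> L" and L: "compact L"
    using locally_compact_space_compact_closed_compact[of "euclidean :: 'a topology"] lc H K
    by (auto simp: compactin_euclidean_iff)
  obtain f where f: "continuous_map euclidean (top_of_set {0..1::real}) f"
    "f ` (- (U \<inter> V)) \<subseteq> {0}" "f ` K \<subseteq> {1}"
  proof (rule Urysohn_completely_regular_compact_closed[of 0 1 "euclidean :: 'a topology" K "- (U \<inter> V)"])
    show "compactin euclidean K" using K by (simp add: compactin_euclidean_iff)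
    show "closedin euclidean (- (U \<inter> V))"
      unfolding closed_closedin[symmetric] using U V by (intro closed_Compl open_Int)
    show "disjnt K (- (U \<inter> V))" using U V by (auto simp: disjnt_def)
  qed (use cr in auto)
  have cont: "continuous_on UNIV f" and r: "0 \<le> f x" "f x \<le> 1" for x
    using f(1) by (auto simp: continuous_map_in_subtopology image_subset_iff)
  show thesis
  proof (rule that)
    have "f x = 0" if "x \<notin> L" for x using that f(2) U by auto
    then show "(\<lambda>x. complex_of_real (f x)) \<in> C0"
      using cont L by (auto simp: C0_def intro!: continuous_intros exI[of _ L])
  qed (use r f in auto)
qed

text \<open>One Urysohn function approximates the indicator of \<open>E\<close> for both measures at
  once: it is 1 on the union of the inner compact sets and 0 off the intersection of the outer open
  sets, so it differs from the indicator only where both variations are small.\<close>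

lemma radon_measure_eq_if_C0:
  fixes \<mu> \<nu> :: "'a::t2_space radon_measure"
  assumes lc: "locally_compact_space (euclidean :: 'a topology)"
    and eq: "\<And>f. f \<in> C0 \<Longrightarrow> radon_integral \<mu> f = radon_integral \<nu> f"
  shows "\<mu> = \<nu>"
proof (rule radon_measure_eqI)
  fix E :: "'a set" assume E: "E \<in> sets borel"
  have "norm (charge \<mu> E - charge \<nu> E) \<le> 0 + e" if e: "e > 0" for e
  proof -
    \<comment> \<open>The integral estimate costs a factor 2 and there are two measures, hence a
      quarter of \<open>e\<close> for each.\<close>
    have e4: "e / 4 > 0" using e by simp
    obtain K1 V1 where 1: "compact K1" "open V1" "K1 \<subseteq> E" "E \<subseteq> V1" "\<bar>\<mu>\<bar>\<^sub>m (V1 - K1) \<le> ennreal (e / 4)"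
      by (rule regular_approx[OF complex_radon_charge E e4])
    obtain K2 V2 where 2: "compact K2" "open V2" "K2 \<subseteq> E" "E \<subseteq> V2" "\<bar>\<nu>\<bar>\<^sub>m (V2 - K2) \<le> ennreal (e / 4)"
      by (rule regular_approx[OF complex_radon_charge E e4])
    let ?K = "K1 \<union> K2" and ?V = "V1 \<inter> V2"
    have KV: "compact ?K" "open ?V" "?K \<subseteq> ?V" using 1 2 by auto
    obtain f :: "'a \<Rightarrow> real" where f: "(\<lambda>x. complex_of_real (f x)) \<in> C0"
      "\<And>x. 0 \<le> f x" "\<And>x. f x \<le> 1" "\<And>x. x \<in> ?K \<Longrightarrow> f x = 1" "\<And>x. x \<notin> ?V \<Longrightarrow> f x = 0"
      by (rule Urysohn_C0[OF lc KV]) blast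
    let ?f = "\<lambda>x. complex_of_real (f x)"
    let ?d = "\<lambda>x. indicator E x + (- 1) * ?f x"
    have bf: "bdd_borel ?f" using f(1) by (rule C0_bdd_borel)
    then have bd: "bdd_borel ?d"
      by (intro bdd_borel_add bdd_borel_mult bdd_borel_indicator bdd_borel_const E)
    \<comment> \<open>\<open>W\<close> and \<open>L\<close> stand for the open and compact set that
      belong to \<open>\<xi>\<close>, so this serves both measures. The difference \<open>?d\<close>
      vanishes off \<open>W - L\<close> and has norm at most 1.\<close>
    have *: "norm (charge \<xi> E - radon_integral \<xi> ?f) \<le> e / 2"
      if le: "\<bar>\<xi>\<bar>\<^sub>m (W - L) \<le> ennreal (e / 4)" and W: "open W" "?V \<subseteq> W" and L: "compact L" "L \<subseteq> ?K"
      for \<xi> :: "'a radon_measure" and W L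
    proof -
      have "charge \<xi> E = radon_integral \<xi> (\<lambda>x. ?f x + ?d x)"
        using radon_integral_indicator[OF E, of \<xi>] by (simp add: eta_contract_eq)
      also have "\<dots> = radon_integral \<xi> ?f + radon_integral \<xi> ?d"
        by (rule radon_integral_add_right[OF bf bd])
      finally have "charge \<xi> E - radon_integral \<xi> ?f = radon_integral \<xi> ?d" by simp
      moreover have "ennreal (norm (radon_integral \<xi> ?d)) \<le> 2 * 1 * \<bar>\<xi>\<bar>\<^sub>m (W - L)"
      proof (rule norm_radon_integral_le[OF bd])
        show "W - L \<in> sets borel" using W L by (intro sets.Diff) (simp_all add: borel_open borel_compact)
        fix x
        have "?d x = complex_of_real (indicator E x - f x)" by (simp add: indicator_def)
        then have "norm (?d x) = \<bar>indicator E x - f x\<bar>" by (simp only: norm_of_real)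
        then have "norm (?d x) \<le> 1"
          using f(2,3)[of x] by (auto simp: indicator_def)
        moreover have "?d x = 0" if "x \<notin> W - L"
        proof (cases "x \<in> W")
          case True
          then have "x \<in> ?K" using that L by blast
          then show ?thesis using f(4)[of x] 1(3) 2(3) by (auto simp: indicator_def)
        next
          case False
          then have "x \<notin> ?V" using W by blast
          then show ?thesis using f(5)[of x] 1(4) 2(4) by (auto simp: indicator_def)
        qed
        ultimately show "ennreal (norm (?d x)) \<le> 1 * indicator (W - L) x"
          by (cases "x \<in> W - L") (simp_all add: ennreal_le_1)
      qed
      moreover have "2 * 1 * \<bar>\<xi>\<bar>\<^sub>m (W - L) \<le> 2 * ennreal (e / 4)"
        using le by (auto intro: mult_left_mono)
      moreover have "2 * ennreal (e / 4) = ennreal (e / 2)"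
        using e by (simp flip: ennreal_numeral ennreal_mult)
      ultimately have "ennreal (norm (charge \<xi> E - radon_integral \<xi> ?f)) \<le> ennreal (e / 2)" by simp
      then show ?thesis using e by simp
    qed
    have "norm (charge \<mu> E - radon_integral \<mu> ?f) \<le> e / 2"
      by (rule *[OF 1(5)]) (use 1 in auto)
    moreover have "norm (charge \<nu> E - radon_integral \<nu> ?f) \<le> e / 2"
      by (rule *[OF 2(5)]) (use 2 in auto)
    moreover have "charge \<mu> E - charge \<nu> E =
        (charge \<mu> E - radon_integral \<mu> ?f) - (charge \<nu> E - radon_integral \<nu> ?f)"
      by (simp add: eq[OF f(1)])
    ultimately show ?thesis
      using norm_triangle_ineq4[of "charge \<mu> E - radon_integral \<mu> ?f" "charge \<nu> E - radon_integral \<nu> ?f"] by simp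
  qed
  then show "charge \<mu> E = charge \<nu> E"
    using field_le_epsilon[of "norm (charge \<mu> E - charge \<nu> E)" 0] by simp
qed

text \<open>Change of variables shows that the push-forward satisfies the duality relation; since
  \<open>C0\<close> separates measures, it is the only one that does, which resolves the definite
  description.\<close>

lemma adjoint_eq_push:
  fixes \<phi> :: "'a::t2_space \<Rightarrow> 'a"
  assumes lc: "locally_compact_space (euclidean :: 'a topology)"
    and \<phi>: "homeomorphism UNIV UNIV \<phi> \<psi>" and g: "bdd_borel g"
    and T: "\<And>f. T f = (\<lambda>x. f (\<phi> x) * g x)"
  shows "adjoint_on_measures T = push \<phi> g"
proof
  fix \<mu> :: "'a radon_measure"
  have *: "\<forall>f\<in>C0. radon_integral (push \<phi> g \<mu>) f = radon_integral \<mu> (T f)"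
    by (simp add: T radon_integral_push[OF \<phi> g] C0_bdd_borel)
  show "adjoint_on_measures T \<mu> = push \<phi> g \<mu>"
    unfolding adjoint_on_measures_def
    by (rule the_equality, rule *, rule radon_measure_eq_if_C0[OF lc]) (use * in auto)
qed

section \<open>Iterates and restrictions\<close>

lemma homeomorphism_funpow:
  fixes \<phi> \<psi> :: "'a::topological_space \<Rightarrow> 'a"
  assumes "homeomorphism UNIV UNIV \<phi> \<psi>"
  shows "homeomorphism UNIV UNIV (\<phi> ^^ n) (\<psi> ^^ n)"
proof (induction n)
  case 0
  then show ?case by (simp add: homeomorphism_def id_def)
next
  case (Suc n)
  show ?case
    using homeomorphism_comp[OF assms Suc] by (simp add: o_def funpow_swap1)
qed

lemma bdd_borel_prod:
  fixes n :: nat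
  assumes "\<And>j. bdd_borel (f j)"
  shows "bdd_borel (\<lambda>x. \<Prod>j<n. f j x)"
  by (induction n) (simp_all add: bdd_borel_const bdd_borel_mult assms)

text \<open>By \<open>push_push\<close>, each further application multiplies the weight by
  \<open>g\<close> at the current point of the orbit of \<open>\<phi>\<close>.\<close>

lemma push_funpow:
  assumes \<phi>: "homeomorphism UNIV UNIV \<phi> \<psi>" and g: "bdd_borel g"
  shows "push \<phi> g ^^ n = push (\<phi> ^^ n) (\<lambda>x. \<Prod>j<n. g ((\<phi> ^^ j) x))"
proof (induction n)
  case 0
  then show ?case by (simp add: fun_eq_iff push_id)
next
  case (Suc n)
  have "bdd_borel (\<lambda>x. \<Prod>j<n. g ((\<phi> ^^ j) x))"
    by (intro bdd_borel_prod bdd_borel_compose[OF homeomorphism_funpow[OF \<phi>]] g)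
  then show ?case
    by (simp add: Suc fun_eq_iff push_push[OF \<phi> homeomorphism_funpow[OF \<phi>] g] o_def mult.commute)
qed

lemma funpow_cancel:
  fixes f g :: "'a \<Rightarrow> 'a"
  assumes "\<And>x. f (g x) = x" shows "(f ^^ n) ((g ^^ n) x) = x"
  by (induction n arbitrary: x) (simp_all add: assms funpow_swap1)

text \<open>Encoded as a push-forward along the identity so that the composition law and the norm
  bounds of \<open>push\<close> apply; the factor 2 in the bounds below comes from there.\<close>

definition restrict_radon :: "'a set \<Rightarrow> 'a::t2_space radon_measure \<Rightarrow> 'a radon_measure" where
  "restrict_radon B = push (\<lambda>x. x) (indicator B)"

lemma restrict_radon_Un:
  assumes "A \<in> sets borel" "B \<in> sets borel" "A \<inter> B = {}"
  shows "restrict_radon (A \<union> B) \<mu> = restrict_radon A \<mu> + restrict_radon B \<mu>"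
proof -
  have "indicator (A \<union> B) = (\<lambda>x. indicator A x + indicator B x :: complex)"
    using assms(3) by (auto simp: fun_eq_iff indicator_def)
  then show ?thesis
    unfolding restrict_radon_def
    by (simp add: push_add_weight[OF homeomorphism_id] bdd_borel_indicator assms)
qed

lemma restrict_radon_UNIV: "restrict_radon UNIV \<mu> = \<mu>"
proof -
  have "indicator UNIV = (\<lambda>x. 1 :: complex)" by (simp add: fun_eq_iff)
  then show ?thesis using push_id[of \<mu>] by (simp add: restrict_radon_def)
qed

lemma abs_restrict_radon_le:
  assumes "B \<in> sets borel" "E \<in> sets borel"
  shows "\<bar>restrict_radon B \<mu>\<bar>\<^sub>m E \<le> 2 * \<bar>\<mu>\<bar>\<^sub>m (E \<inter> B)"
  unfolding restrict_radon_def
  using abs_push_le[OF homeomorphism_id bdd_borel_indicator[OF assms(1)] assms, of 1 \<mu>]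
  by (simp add: indicator_def)

lemma norm_restrict_radon_le:
  assumes "B \<in> sets borel"
  shows "ennreal (norm (restrict_radon B \<mu>)) \<le> 2 * \<bar>\<mu>\<bar>\<^sub>m B"
  using abs_restrict_radon_le[OF assms, of UNIV \<mu>] by (simp add: ennreal_norm_eq)

text \<open>Restriction merges into the weight as a factor \<open>indicator B\<close>, so only the
  size of \<open>g\<close> on \<open>B\<close> matters.\<close>

lemma norm_push_restrict_le:
  assumes \<phi>: "homeomorphism UNIV UNIV \<phi> \<psi>" and g: "bdd_borel g" and B: "B \<in> sets borel"
    and C: "\<And>x. x \<in> B \<Longrightarrow> ennreal (norm (g x)) \<le> C"
  shows "ennreal (norm (push \<phi> g (restrict_radon B \<mu>))) \<le> (2 * ennreal (norm \<mu>)) * C"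
proof -
  have "push \<phi> g (restrict_radon B \<mu>) = push \<phi> (\<lambda>x. g x * indicator B x) \<mu>"
    unfolding restrict_radon_def by (rule push_push[OF \<phi> homeomorphism_id g bdd_borel_indicator[OF B]])
  also have "ennreal (norm \<dots>) \<le> 2 * C * \<bar>\<mu>\<bar>\<^sub>m B"
    by (rule norm_push_le[OF \<phi> bdd_borel_mult[OF g bdd_borel_indicator[OF B]] B]) (simp add: C split: split_indicator)
  also have "\<dots> \<le> 2 * C * \<bar>\<mu>\<bar>\<^sub>m UNIV"
    using B by (intro mult_left_mono total_variation_mono) auto
  finally show ?thesis by (simp add: ennreal_norm_eq mult_ac)
qed

text \<open>Bridges extended-valued bounds and norm convergence; finiteness of \<open>c\<close>
  makes \<open>c * b k\<close> tend to 0.\<close>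

lemma tendsto_0_ennreal_bound:
  fixes a :: "nat \<Rightarrow> 'b::real_normed_vector"
  assumes "\<And>k. ennreal (norm (a k)) \<le> c * b k" "c < \<infinity>" "b \<longlonglongrightarrow> 0"
  shows "a \<longlonglongrightarrow> 0"
proof -
  have "(\<lambda>k. c * b k) \<longlonglongrightarrow> c * 0"
    using assms(2,3) by (intro ennreal_tendsto_cmult) auto
  then have "(\<lambda>k. ennreal (norm (a k))) \<longlonglongrightarrow> ennreal 0"
    using assms(1) by (intro tendsto_sandwich[of "\<lambda>_. 0" "\<lambda>k. ennreal (norm (a k))" sequentially "\<lambda>k. c * b k"]) auto
  then show ?thesis
    by (subst (asm) tendsto_ennreal_iff) (auto intro: tendsto_norm_zero_cancel)
qed

text \<open>Inner regularity on the whole space leaves little variation off some compact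
  \<open>K\<close>, so restricting a measure of \<open>U\<close> to \<open>K\<close> moves it only
  slightly.\<close>

lemma compactly_supported_dense:
  fixes U :: "'a::t2_space radon_measure set"
  assumes "open U" "U \<noteq> {}"
  obtains \<nu> K where "\<nu> \<in> U" "compact K" "\<bar>\<nu>\<bar>\<^sub>m (- K) = 0"
proof -
  obtain \<mu> where "\<mu> \<in> U" using assms(2) by blast
  then obtain e where e: "e > 0" "ball \<mu> e \<subseteq> U" using assms(1) openE by blast
  \<comment> \<open>The factor 2 of \<open>norm_restrict_radon_le\<close> turns this into
    \<open>e / 2\<close>, strictly below the radius.\<close>
  have "e / 4 > 0" using e by simp
  then obtain K V where K: "compact K" "open V" "K \<subseteq> UNIV" "UNIV \<subseteq> V" "\<bar>\<mu>\<bar>\<^sub>m (V - K) \<le> ennreal (e / 4)"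
    using regular_approx[OF complex_radon_charge, of UNIV "e / 4" \<mu>] by auto
  have Kb: "K \<in> sets borel" "- K \<in> sets borel" using K by (simp_all add: borel_compact borel_comp)
  have le: "\<bar>\<mu>\<bar>\<^sub>m (- K) \<le> ennreal (e / 4)"
    using K(4,5) by (simp add: Compl_eq_Diff_UNIV top.extremum_unique)
  show thesis
  proof (rule that)
    have "\<mu> = restrict_radon K \<mu> + restrict_radon (- K) \<mu>"
      using restrict_radon_Un[of K "- K" \<mu>] Kb by (simp add: restrict_radon_UNIV)
    then have d: "dist \<mu> (restrict_radon K \<mu>) = norm (restrict_radon (- K) \<mu>)"
      by (metis add_diff_cancel_left' dist_norm)
    have "ennreal (norm (restrict_radon (- K) \<mu>)) \<le> 2 * ennreal (e / 4)"
      by (rule order_trans[OF norm_restrict_radon_le[OF Kb(2)]]) (intro mult_left_mono le, simp)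
    also have "\<dots> = ennreal (e / 2)" using e by (simp flip: ennreal_numeral ennreal_mult)
    finally have "norm (restrict_radon (- K) \<mu>) < e" using e by simp
    then show "restrict_radon K \<mu> \<in> U" using e d by (auto simp: subset_iff)
    show "\<bar>restrict_radon K \<mu>\<bar>\<^sub>m (- K) = 0"
      using abs_restrict_radon_le[OF Kb, of \<mu>] by (simp add: total_variation_empty vector_measure_charge)
  qed (rule K)
qed

section \<open>Weighted composition operators\<close>

text \<open>The inverse is a parameter \<open>\<beta>\<close> of its own, so that the two directions
  are treated alike. The bounds \<open>c\<close> and \<open>d\<close> enter the constant that
  compares shifted products of weights.\<close>

locale weighted_homeomorphism =
  fixes \<alpha> \<beta> :: "'a::t2_space \<Rightarrow> 'a" and w :: "'a \<Rightarrow> real" and c d :: real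
  assumes locally_compact: "locally_compact_space (euclidean :: 'a topology)"
    and \<alpha>: "homeomorphism UNIV UNIV \<alpha> \<beta>" and \<beta>: "homeomorphism UNIV UNIV \<beta> \<alpha>"
    and w_continuous: "continuous_on UNIV w" and w_pos: "\<And>x. w x > 0"
    and w_le: "\<And>x. w x \<le> c" and inverse_w_le: "\<And>x. 1 / w x \<le> d"
begin

lemma \<alpha>\<beta>: "\<alpha> (\<beta> x) = x" and \<beta>\<alpha>: "\<beta> (\<alpha> x) = x"
  using \<beta> by (simp_all add: homeomorphism_def)

lemma w_nonzero: "w x \<noteq> 0"
  using w_pos[of x] by simp

text \<open>The weights are made complex because \<open>push\<close> takes complex weights.
  \<open>T\<close> and \<open>S\<close> are explicit candidates, identified with the adjoints in
  \<open>adjoint_T\<close> and \<open>adjoint_S\<close>.\<close>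

definition "W x = complex_of_real (w x)"
definition "W' x = complex_of_real (1 / w (\<beta> x))"
definition "T = push \<alpha> W"
definition "S = push \<beta> W'"

lemma bdd_borel_W: "bdd_borel W"
proof (rule bdd_borelI)
  show "W \<in> borel_measurable borel" unfolding W_def[abs_def]
    using w_continuous by (intro borel_measurable_continuous_onI continuous_intros)
  show "norm (W x) \<le> c" for x using w_le[of x] w_pos[of x] by (simp add: W_def)
qed

lemma bdd_borel_W': "bdd_borel W'"
proof (rule bdd_borelI)
  have "continuous_on UNIV (\<lambda>x. w (\<beta> x))"
    using continuous_on_compose2[OF w_continuous, of UNIV \<beta>] \<beta> by (simp add: homeomorphism_def)
  then show "W' \<in> borel_measurable borel" unfolding W'_def[abs_def]
    by (intro borel_measurable_continuous_onI continuous_intros) (simp_all add: w_nonzero)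
  show "norm (W' x) \<le> d" for x
    using inverse_w_le[of "\<beta> x"] w_pos[of "\<beta> x"] by (simp add: W'_def norm_divide)
qed

lemma bdd_borel_prod_W: "bdd_borel (\<lambda>x. \<Prod>j<n. W ((\<alpha> ^^ j) x))"
  by (intro bdd_borel_prod bdd_borel_compose[OF homeomorphism_funpow[OF \<alpha>]] bdd_borel_W)

lemma bdd_borel_prod_W': "bdd_borel (\<lambda>x. \<Prod>j<n. W' ((\<beta> ^^ j) x))"
  by (intro bdd_borel_prod bdd_borel_compose[OF homeomorphism_funpow[OF \<beta>]] bdd_borel_W')

lemma adjoint_T: "adjoint_on_measures (weighted_comp \<alpha> w) = T"
  unfolding T_def
  by (rule adjoint_eq_push[OF locally_compact \<alpha> bdd_borel_W]) (simp add: weighted_comp_def W_def mult.commute)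

lemma adjoint_S: "adjoint_on_measures (weighted_comp_inv \<alpha> w) = S"
proof -
  have "inv \<alpha> = \<beta>" by (rule inv_equality) (simp_all add: \<alpha>\<beta> \<beta>\<alpha>)
  then show ?thesis
    unfolding S_def
    by (intro adjoint_eq_push[OF locally_compact \<beta> bdd_borel_W']) (simp add: weighted_comp_inv_def W'_def)
qed

text \<open>The weights cancel along the composed map: \<open>W (\<beta> x) * W' x\<close> is
  \<open>w (\<beta> x) / w (\<beta> x)\<close>.\<close>

lemma T_S: "T (S \<mu>) = \<mu>"
proof -
  have "T (S \<mu>) = push (\<lambda>x. \<alpha> (\<beta> x)) (\<lambda>x. W (\<beta> x) * W' x) \<mu>"
    unfolding T_def S_def by (rule push_push[OF \<alpha> \<beta> bdd_borel_W bdd_borel_W'])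
  also have "\<dots> = push (\<lambda>x. x) (\<lambda>x. 1) \<mu>" by (simp add: \<alpha>\<beta> W_def W'_def w_nonzero)
  finally show ?thesis by (simp add: push_id)
qed

lemma S_T: "S (T \<mu>) = \<mu>"
proof -
  have "S (T \<mu>) = push (\<lambda>x. \<beta> (\<alpha> x)) (\<lambda>x. W' (\<alpha> x) * W x) \<mu>"
    unfolding T_def S_def by (rule push_push[OF \<beta> \<alpha> bdd_borel_W' bdd_borel_W])
  also have "\<dots> = push (\<lambda>x. x) (\<lambda>x. 1) \<mu>" by (simp add: \<beta>\<alpha> W_def W'_def w_nonzero)
  finally show ?thesis by (simp add: push_id)
qed

section \<open>Powers of the adjoints and their norm estimates\<close>

lemma T_funpow: "T ^^ n = push (\<alpha> ^^ n) (\<lambda>x. \<Prod>j<n. W ((\<alpha> ^^ j) x))"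
  unfolding T_def by (rule push_funpow[OF \<alpha> bdd_borel_W])

lemma S_funpow: "S ^^ n = push (\<beta> ^^ n) (\<lambda>x. \<Prod>j<n. W' ((\<beta> ^^ j) x))"
  unfolding S_def by (rule push_funpow[OF \<beta> bdd_borel_W'])

lemma funpow_add_scaleR:
  shows T_funpow_add: "(T ^^ n) (\<mu> + \<nu>) = (T ^^ n) \<mu> + (T ^^ n) \<nu>"
    and T_funpow_scaleR: "(T ^^ n) (r *\<^sub>R \<mu>) = r *\<^sub>R (T ^^ n) \<mu>"
    and S_funpow_add: "(S ^^ n) (\<mu> + \<nu>) = (S ^^ n) \<mu> + (S ^^ n) \<nu>"
    and S_funpow_scaleR: "(S ^^ n) (r *\<^sub>R \<mu>) = r *\<^sub>R (S ^^ n) \<mu>"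
  unfolding T_funpow S_funpow
  by (rule push_add[OF homeomorphism_funpow[OF \<alpha>] bdd_borel_prod_W]
        push_scaleR[OF homeomorphism_funpow[OF \<alpha>] bdd_borel_prod_W]
        push_add[OF homeomorphism_funpow[OF \<beta>] bdd_borel_prod_W']
        push_scaleR[OF homeomorphism_funpow[OF \<beta>] bdd_borel_prod_W'])+

lemma norm_T_funpow_le:
  assumes "B \<in> sets borel"
  shows "ennreal (norm ((T ^^ n) (restrict_radon B \<mu>)))
      \<le> (2 * ennreal (norm \<mu>)) * (SUP t\<in>B. ennreal (\<Prod>j<n. w ((\<alpha> ^^ j) t)))"
  unfolding T_funpow
proof (rule norm_push_restrict_le[OF homeomorphism_funpow[OF \<alpha>] bdd_borel_prod_W assms])
  fix x assume x: "x \<in> B"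
  have "norm (\<Prod>j<n. W ((\<alpha> ^^ j) x)) = (\<Prod>j<n. w ((\<alpha> ^^ j) x))"
    unfolding prod_norm[symmetric] using w_pos by (intro prod.cong) (auto simp: W_def less_imp_le)
  then show "ennreal (norm (\<Prod>j<n. W ((\<alpha> ^^ j) x))) \<le> (SUP t\<in>B. ennreal (\<Prod>j<n. w ((\<alpha> ^^ j) t)))"
    using x by (auto intro: SUP_upper)
qed

text \<open>\<open>W'\<close> evaluates \<open>w\<close> one step further along
  \<open>\<beta>\<close>, so the indices below \<open>n\<close> become 1 to
  \<open>n\<close>.\<close>

lemma norm_prod_W': "norm (\<Prod>j<n. W' ((\<beta> ^^ j) x)) = (\<Prod>j=1..n. 1 / w ((\<beta> ^^ j) x))"
proof -
  have "norm (\<Prod>j<n. W' ((\<beta> ^^ j) x)) = (\<Prod>j<n. 1 / w ((\<beta> ^^ Suc j) x))"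
    unfolding prod_norm[symmetric] using w_pos
    by (intro prod.cong) (auto simp: W'_def less_imp_le norm_divide)
  then show ?thesis by (simp add: prod.atLeast1_atMost_eq)
qed

lemma norm_S_funpow_le:
  assumes "B \<in> sets borel"
  shows "ennreal (norm ((S ^^ n) (restrict_radon B \<mu>)))
      \<le> (2 * ennreal (norm \<mu>)) * (SUP t\<in>B. ennreal (\<Prod>j=1..n. 1 / w ((\<beta> ^^ j) t)))"
  unfolding S_funpow
  by (rule norm_push_restrict_le[OF homeomorphism_funpow[OF \<beta>] bdd_borel_prod_W' assms])
    (unfold norm_prod_W', erule SUP_upper)

text \<open>The theorem's hypothesis takes the product over \<open>j = 0..n-1\<close>, whereas the weight of \<open>S\<^sup>n\<close> runs
  over \<open>j = 1..n\<close>.\<close>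

lemma shifted_prod_le:
  "ennreal (\<Prod>j=1..n. 1 / w ((\<beta> ^^ j) x)) \<le> ennreal (c * d) * ennreal (\<Prod>j<n. 1 / w ((\<beta> ^^ j) x))"
proof -
  define p where "p = (\<Prod>j<n. 1 / w ((\<beta> ^^ j) x))"
  define q where "q = (\<Prod>j=1..n. 1 / w ((\<beta> ^^ j) x))"
  have p: "p \<ge> 0" unfolding p_def using w_pos by (intro prod_nonneg) (simp add: less_imp_le)
  \<comment> \<open>The product over 0 to \<open>n\<close> is split in two ways: removing the first
    factor leaves \<open>q\<close>, removing the last leaves \<open>p\<close>. Hence
    \<open>q / p\<close> is a ratio of two values of \<open>w\<close>, at most
    \<open>c * d\<close>.\<close>
  have "1 / w x * q = (\<Prod>j<Suc n. 1 / w ((\<beta> ^^ j) x))"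
    unfolding prod.lessThan_Suc_shift q_def by (simp add: prod.atLeast1_atMost_eq)
  also have "\<dots> = p * (1 / w ((\<beta> ^^ n) x))" by (simp add: p_def)
  finally have "q = (w x * (1 / w ((\<beta> ^^ n) x))) * p"
    using w_nonzero[of x] w_nonzero[of "(\<beta> ^^ n) x"] by (simp add: field_simps)
  also have "\<dots> \<le> (c * d) * p"
  proof (intro mult_right_mono mult_mono w_le inverse_w_le p)
    show "0 \<le> c" using w_le[of x] w_pos[of x] by simp
    show "0 \<le> 1 / w ((\<beta> ^^ n) x)" using w_pos by (simp add: less_imp_le)
  qed
  finally have "ennreal q \<le> ennreal ((c * d) * p)" by (rule ennreal_leI)
  also have "\<dots> = ennreal (c * d) * ennreal p" using p by (rule ennreal_mult'')
  finally show ?thesis unfolding p_def q_def .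
qed

lemma norm_S_funpow_le_shifted:
  assumes "B \<in> sets borel"
  shows "ennreal (norm ((S ^^ n) (restrict_radon B \<mu>)))
      \<le> (2 * ennreal (norm \<mu>) * ennreal (c * d)) * (SUP t\<in>B. ennreal (\<Prod>j<n. 1 / w ((\<beta> ^^ j) t)))"
proof -
  have "(SUP t\<in>B. ennreal (\<Prod>j=1..n. 1 / w ((\<beta> ^^ j) t)))
      \<le> ennreal (c * d) * (SUP t\<in>B. ennreal (\<Prod>j<n. 1 / w ((\<beta> ^^ j) t)))"
    by (rule SUP_least, rule order_trans[OF shifted_prod_le], rule mult_left_mono, erule SUP_upper, simp)
  from order_trans[OF norm_S_funpow_le[OF assms] mult_left_mono[OF this]]
  show ?thesis by (simp only: mult.assoc zero_le simp_thms)
qed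

text \<open>The factors 2 cancel the 1/2 of the cosine. Equal directions add up to powers
  \<open>2 * n\<close>, while opposite directions cancel and return \<open>\<nu>\<close> and
  \<open>\<rho>\<close> themselves; with \<open>\<nu>\<close> and \<open>\<rho>\<close> two pieces
  of the target, these leftovers rebuild it.\<close>

lemma cosine_adjoint_perturbed:
  "cosine_adjoint \<alpha> w n (\<mu> + (2 *\<^sub>R (T ^^ n) \<nu> + 2 *\<^sub>R (S ^^ n) \<rho>)) =
    (1 / 2) *\<^sub>R (T ^^ n) \<mu> + (1 / 2) *\<^sub>R (S ^^ n) \<mu> + (T ^^ (2 * n)) \<nu> + (S ^^ (2 * n)) \<rho> + (\<nu> + \<rho>)"
proof -
  have "(T ^^ n) ((T ^^ n) \<xi>) = (T ^^ (2 * n)) \<xi>"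
    and "(S ^^ n) ((S ^^ n) \<xi>) = (S ^^ (2 * n)) \<xi>" for \<xi>
    by (simp_all add: mult_2 funpow_add)
  then show ?thesis
    unfolding cosine_adjoint_def adjoint_T adjoint_S
    by (simp add: T_funpow_add S_funpow_add T_funpow_scaleR S_funpow_scaleR
      funpow_cancel[of T S, OF T_S] funpow_cancel[of S T, OF S_T] scaleR_add_right)
qed

end

section \<open>Approximating sequences for the cosine operators\<close>

lemma restrict_radon_Compl_tendsto_0:
  assumes K: "compact K" "\<bar>\<rho>\<bar>\<^sub>m (- K) = 0" and A: "\<And>k. A k \<in> sets borel"
    and lim: "(\<lambda>k. \<bar>\<rho>\<bar>\<^sub>m (A k)) \<longlonglongrightarrow> 0"
  shows "(\<lambda>k. restrict_radon (- (K \<inter> - A k)) \<rho>) \<longlonglongrightarrow> 0"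
proof (rule tendsto_0_ennreal_bound[OF _ _ lim])
  fix k
  have Kb: "K \<in> sets borel" "- K \<in> sets borel" using K by (simp_all add: borel_compact borel_comp)
  have em: "emeasure (variation_measure (charge \<rho>)) E = \<bar>\<rho>\<bar>\<^sub>m E" if "E \<in> sets borel" for E
    by (rule emeasure_variation_measure[OF vector_measure_charge that])
  \<comment> \<open>The variation vanishes off \<open>K\<close>, so only \<open>A k\<close>
    contributes.\<close>
  have eq: "- (K \<inter> - A k) = - K \<union> A k" by auto
  have "\<bar>\<rho>\<bar>\<^sub>m (- (K \<inter> - A k)) \<le> \<bar>\<rho>\<bar>\<^sub>m (- K) + \<bar>\<rho>\<bar>\<^sub>m (A k)"
    using emeasure_subadditive[of "- K" "variation_measure (charge \<rho>)" "A k"] Kb A[of k]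
    unfolding eq by (simp add: em sets.Un)
  then have le: "\<bar>\<rho>\<bar>\<^sub>m (- (K \<inter> - A k)) \<le> \<bar>\<rho>\<bar>\<^sub>m (A k)" using K by simp
  have "ennreal (norm (restrict_radon (- (K \<inter> - A k)) \<rho>)) \<le> 2 * \<bar>\<rho>\<bar>\<^sub>m (- (K \<inter> - A k))"
    using Kb A[of k] unfolding eq by (intro norm_restrict_radon_le sets.Un)
  also have "\<dots> \<le> 2 * \<bar>\<rho>\<bar>\<^sub>m (A k)" using le by (intro mult_left_mono) auto
  finally show "ennreal (norm (restrict_radon (- (K \<inter> - A k)) \<rho>)) \<le> 2 * \<bar>\<rho>\<bar>\<^sub>m (A k)" .
qed simp

text \<open>The first two limits do double duty: they make the \<open>n k\<close>-th powers of
  \<open>T\<close> and \<open>S\<close> small on \<open>\<mu>\<close> restricted to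
  \<open>K - A k\<close>, and also on the pieces of \<open>\<nu>\<close> over \<open>F k\<close> and
  \<open>D k\<close>, which lie in that set. The last two limits treat the doubled powers that
  appear when the cosine acts on these pieces.\<close>

lemma (in weighted_homeomorphism) cosine_adjoint_approximants:
  fixes A F D :: "nat \<Rightarrow> 'a set"
  assumes K: "compact K" and null: "\<bar>\<mu>\<bar>\<^sub>m (- K) = 0" "\<bar>\<nu>\<bar>\<^sub>m (- K) = 0"
    and sets: "\<And>k. A k \<in> sets borel" "\<And>k. F k \<in> sets borel" "\<And>k. D k \<in> sets borel"
    and A: "(\<lambda>k. \<bar>\<mu>\<bar>\<^sub>m (A k)) \<longlonglongrightarrow> 0" "(\<lambda>k. \<bar>\<nu>\<bar>\<^sub>m (A k)) \<longlonglongrightarrow> 0"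
    and lim: "(\<lambda>k. SUP t\<in>K \<inter> - A k. ennreal (\<Prod>j<n k. w ((\<alpha> ^^ j) t))) \<longlonglongrightarrow> 0"
      "(\<lambda>k. SUP t\<in>K \<inter> - A k. ennreal (\<Prod>j<n k. 1 / w ((\<beta> ^^ j) t))) \<longlonglongrightarrow> 0"
      "(\<lambda>k. SUP t\<in>F k. ennreal (\<Prod>j<2 * n k. w ((\<alpha> ^^ j) t))) \<longlonglongrightarrow> 0"
      "(\<lambda>k. SUP t\<in>D k. ennreal (\<Prod>j=1..2 * n k. 1 / w ((\<beta> ^^ j) t))) \<longlonglongrightarrow> 0"
    and FD: "\<And>k. F k \<inter> D k = {}" "\<And>k. - A k \<inter> K = F k \<union> D k"
  shows "\<exists>x. x \<longlonglongrightarrow> \<mu> \<and> (\<lambda>k. cosine_adjoint \<alpha> w (n k) (x k)) \<longlonglongrightarrow> \<nu>"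
proof -
  define B where "B k = K \<inter> - A k" for k
  have B: "B k \<in> sets borel" for k unfolding B_def using K sets by (simp add: borel_compact borel_comp sets.Int)
  have BFD: "B k = F k \<union> D k" for k using FD(2)[of k] by (auto simp: B_def)
  \<comment> \<open>Restrictions to \<open>B k\<close> are written as differences because the
    complementary restrictions are known to tend to 0.\<close>
  have split: "restrict_radon (B k) \<rho> = \<rho> - restrict_radon (- B k) \<rho>" for k and \<rho> :: "'a radon_measure"
    using restrict_radon_Un[of "B k" "- B k" \<rho>, symmetric] B[of k]
    by (simp add: restrict_radon_UNIV eq_diff_eq borel_comp)
  have splitFD: "restrict_radon (F k) \<nu> + restrict_radon (D k) \<nu> = \<nu> - restrict_radon (- B k) \<nu>" for k
    using restrict_radon_Un[OF sets(2)[of k] sets(3)[of k] FD(1), of \<nu>]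
    by (simp only: BFD[symmetric] split)
  note rest = restrict_radon_Compl_tendsto_0[OF K null(1) sets(1) A(1), folded B_def]
    restrict_radon_Compl_tendsto_0[OF K null(2) sets(1) A(2), folded B_def]
  have fin: "2 * ennreal (norm \<rho>) < \<infinity>" "2 * ennreal (norm \<rho>) * ennreal (c * d) < \<infinity>" for \<rho> :: "'a radon_measure"
    by (simp_all add: ennreal_mult_less_top)
  \<comment> \<open>\<open>F k\<close> and \<open>D k\<close> are subsets of \<open>B k\<close>, so
    the limits over \<open>B k\<close> control the correction terms in \<open>x k\<close>.\<close>
  have SUP_le: "(SUP t\<in>F k. f t) \<le> (SUP t\<in>B k. f t)" "(SUP t\<in>D k. f t) \<le> (SUP t\<in>B k. f t)"
    for f :: "'a \<Rightarrow> ennreal" and k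
    by (rule SUP_subset_mono; simp add: BFD)+
  have T\<mu>: "(\<lambda>k. (T ^^ n k) (restrict_radon (B k) \<mu>)) \<longlonglongrightarrow> 0"
    by (rule tendsto_0_ennreal_bound[OF norm_T_funpow_le[OF B] fin(1) lim(1)[folded B_def]])
  \<comment> \<open>The second limit concerns products over 0 to \<open>n k - 1\<close>, hence the
    shifted estimate; the fourth already runs from 1 to \<open>2 * n k\<close>.\<close>
  have S\<mu>: "(\<lambda>k. (S ^^ n k) (restrict_radon (B k) \<mu>)) \<longlonglongrightarrow> 0"
    by (rule tendsto_0_ennreal_bound[OF norm_S_funpow_le_shifted[OF B] fin(2) lim(2)[folded B_def]])
  have T\<nu>: "(\<lambda>k. (T ^^ n k) (restrict_radon (F k) \<nu>)) \<longlonglongrightarrow> 0"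
    by (rule tendsto_0_ennreal_bound[OF order_trans[OF norm_T_funpow_le[OF sets(2)]
          mult_left_mono[OF SUP_le(1)]] fin(1) lim(1)[folded B_def]]) simp
  have S\<nu>: "(\<lambda>k. (S ^^ n k) (restrict_radon (D k) \<nu>)) \<longlonglongrightarrow> 0"
    by (rule tendsto_0_ennreal_bound[OF order_trans[OF norm_S_funpow_le_shifted[OF sets(3)]
          mult_left_mono[OF SUP_le(2)]] fin(2) lim(2)[folded B_def]]) simp
  have TT\<nu>: "(\<lambda>k. (T ^^ (2 * n k)) (restrict_radon (F k) \<nu>)) \<longlonglongrightarrow> 0"
    by (rule tendsto_0_ennreal_bound[OF norm_T_funpow_le[OF sets(2)] fin(1) lim(3)])
  have SS\<nu>: "(\<lambda>k. (S ^^ (2 * n k)) (restrict_radon (D k) \<nu>)) \<longlonglongrightarrow> 0"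
    by (rule tendsto_0_ennreal_bound[OF norm_S_funpow_le[OF sets(3)] fin(1) lim(4)])
  define x where "x k = restrict_radon (B k) \<mu> + (2 *\<^sub>R (T ^^ n k) (restrict_radon (F k) \<nu>)
    + 2 *\<^sub>R (S ^^ n k) (restrict_radon (D k) \<nu>))" for k
  have "x \<longlonglongrightarrow> \<mu> - 0 + (2 *\<^sub>R 0 + 2 *\<^sub>R 0)"
    unfolding x_def[abs_def] split by (intro tendsto_add tendsto_diff tendsto_scaleR tendsto_const rest T\<nu> S\<nu>)
  then have x: "x \<longlonglongrightarrow> \<mu>" by simp
  have "(\<lambda>k. cosine_adjoint \<alpha> w (n k) (x k)) \<longlonglongrightarrow> (1 / 2) *\<^sub>R 0 + (1 / 2) *\<^sub>R 0 + 0 + 0 + (\<nu> - 0)"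
    unfolding x_def cosine_adjoint_perturbed splitFD
    by (intro tendsto_add tendsto_diff tendsto_scaleR tendsto_const rest T\<mu> S\<mu> TT\<nu> SS\<nu>)
  then have "(\<lambda>k. cosine_adjoint \<alpha> w (n k) (x k)) \<longlonglongrightarrow> \<nu>" by simp
  with x show ?thesis by blast
qed

text \<open>Suprema are taken in \<open>ennreal\<close>, where the supremum over the empty set is 0.
  Density reduces the claim to measures of \<open>U\<close> and \<open>V\<close> carried by compact
  sets; convergence of the approximants and of their images then puts all late terms into the two
  open sets.\<close>

theorem proposition3p3:
  fixes \<alpha> :: "'a::t2_space \<Rightarrow> 'a" and w :: "'a \<Rightarrow> real"
  assumes "locally_compact_space (euclidean :: 'a topology)"
    and "homeomorphism UNIV UNIV \<alpha> (inv \<alpha>)"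
    and "aperiodic \<alpha>"
    and "\<And>x. w x > 0" and "bounded (range w)" and "(\<lambda>x. 1 / w x) \<in> bcontfun"
    and "\<And>K (\<mu> :: 'a radon_measure) \<nu>.
      \<lbrakk>compact K; \<bar>\<mu>\<bar>\<^sub>m (- K) = 0; \<bar>\<nu>\<bar>\<^sub>m (- K) = 0\<rbrakk> \<Longrightarrow>
      \<exists>(n :: nat \<Rightarrow> nat) (A :: nat \<Rightarrow> 'a set) (F :: nat \<Rightarrow> 'a set) (D :: nat \<Rightarrow> 'a set).
        strict_mono n \<and> (\<forall>k. n k \<ge> 1) \<and>
        (\<forall>k. A k \<in> sets borel \<and> A k \<subseteq> K \<and> F k \<in> sets borel \<and> F k \<subseteq> K \<and>
             D k \<in> sets borel \<and> D k \<subseteq> K) \<and>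
        (\<lambda>k. \<bar>\<mu>\<bar>\<^sub>m (A k)) \<longlonglongrightarrow> 0 \<and>
        (\<lambda>k. \<bar>\<nu>\<bar>\<^sub>m (A k)) \<longlonglongrightarrow> 0 \<and>
        (\<lambda>k. SUP t\<in>K \<inter> - A k. ennreal (\<Prod>j<n k. w ((\<alpha> ^^ j) t))) \<longlonglongrightarrow> 0 \<and>
        (\<lambda>k. SUP t\<in>K \<inter> - A k. ennreal (\<Prod>j<n k. 1 / w ((inv \<alpha> ^^ j) t))) \<longlonglongrightarrow> 0 \<and>
        (\<lambda>k. SUP t\<in>F k. ennreal (\<Prod>j<2 * n k. w ((\<alpha> ^^ j) t))) \<longlonglongrightarrow> 0 \<and>
        (\<lambda>k. SUP t\<in>D k. ennreal (\<Prod>j=1..2 * n k. 1 / w ((inv \<alpha> ^^ j) t))) \<longlonglongrightarrow> 0 \<and>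
        (\<forall>k. F k \<inter> D k = {} \<and> - A k \<inter> K = F k \<union> D k)"
  shows "hyper_transitive (cosine_adjoint \<alpha> w)"
proof -
  note w = assms(4)
  obtain c where c: "\<And>x. w x \<le> c" using assms(5) w by (force simp: bounded_iff abs_le_iff)
  obtain d where d: "\<And>x. 1 / w x \<le> d"
    using assms(6) by (force simp: bcontfun_def bounded_iff abs_le_iff)
  \<comment> \<open>Continuity of \<open>w\<close> is recovered from that of its reciprocal, which
    has no zeros.\<close>
  have "continuous_on UNIV (\<lambda>x. 1 / w x)" using assms(6) by (simp add: bcontfun_def)
  moreover have "w x \<noteq> 0" for x using w[of x] by simp
  ultimately have cont: "continuous_on UNIV w"
    using continuous_on_inverse[of UNIV "\<lambda>x. 1 / w x"] by simp
  interpret weighted_homeomorphism \<alpha> "inv \<alpha>" w c d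
    by (rule weighted_homeomorphism.intro)
      (fact assms(1,2) homeomorphism_symD[OF assms(2)] cont w c d)+
  show ?thesis
    unfolding hyper_transitive_def
  proof (intro allI impI)
    fix U V :: "'a radon_measure set"
    assume U: "open U" "U \<noteq> {}" and V: "open V" "V \<noteq> {}"
    obtain \<mu> K\<^sub>1 where \<mu>: "\<mu> \<in> U" "compact K\<^sub>1" "\<bar>\<mu>\<bar>\<^sub>m (- K\<^sub>1) = 0"
      by (rule compactly_supported_dense[OF U])
    obtain \<nu> K\<^sub>2 where \<nu>: "\<nu> \<in> V" "compact K\<^sub>2" "\<bar>\<nu>\<bar>\<^sub>m (- K\<^sub>2) = 0"
      by (rule compactly_supported_dense[OF V])
    \<comment> \<open>A single compact set must carry both measures before the hypothesis can be
      applied.\<close>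
    define K where "K = K\<^sub>1 \<union> K\<^sub>2"
    have K: "compact K" using \<mu> \<nu> by (simp add: K_def compact_Un)
    have Kb: "K \<in> sets borel" "- K \<in> sets borel" "- K\<^sub>1 \<in> sets borel" "- K\<^sub>2 \<in> sets borel"
      using K \<mu>(2) \<nu>(2) by (simp_all add: borel_compact borel_comp)
    have null: "\<bar>\<mu>\<bar>\<^sub>m (- K) = 0" "\<bar>\<nu>\<bar>\<^sub>m (- K) = 0"
      using total_variation_mono[of "- K" "- K\<^sub>1" "charge \<mu>"] total_variation_mono[of "- K" "- K\<^sub>2" "charge \<nu>"]
        \<mu>(3) \<nu>(3) Kb by (auto simp: K_def)
    obtain n x where n: "strict_mono n" "\<And>k. n k \<ge> 1" and x: "x \<longlonglongrightarrow> \<mu>"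
      and Cx: "(\<lambda>k. cosine_adjoint \<alpha> w (n k) (x k)) \<longlonglongrightarrow> \<nu>"
    proof -
      have "\<exists>n x. strict_mono n \<and> (\<forall>k. n k \<ge> 1) \<and> x \<longlonglongrightarrow> \<mu> \<and>
          (\<lambda>k. cosine_adjoint \<alpha> w (n k) (x k)) \<longlonglongrightarrow> \<nu>"
        using assms(7)[OF K null]
      proof (elim exE conjE, goal_cases)
        case (1 n A F D)
        have "\<exists>x. x \<longlonglongrightarrow> \<mu> \<and> (\<lambda>k. cosine_adjoint \<alpha> w (n k) (x k)) \<longlonglongrightarrow> \<nu>"
          by (rule cosine_adjoint_approximants[OF K null, of A F D n]) (use 1 in \<open>simp_all only: simp_thms\<close>)
        with 1 show ?case by blast
      qed
      then show thesis using that by blast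
    qed
    have "\<forall>\<^sub>F k in sequentially. x k \<in> U" using x U(1) \<mu>(1) by (rule topological_tendstoD)
    moreover have "\<forall>\<^sub>F k in sequentially. cosine_adjoint \<alpha> w (n k) (x k) \<in> V"
      using Cx V(1) \<nu>(1) by (rule topological_tendstoD)
    ultimately have "\<forall>\<^sub>F k in sequentially. x k \<in> U \<and> cosine_adjoint \<alpha> w (n k) (x k) \<in> V"
      by (rule eventually_conj)
    then obtain N where N: "\<And>k. k \<ge> N \<Longrightarrow> x k \<in> U \<and> cosine_adjoint \<alpha> w (n k) (x k) \<in> V"
      unfolding eventually_sequentially by blast
    \<comment> \<open>Dropping the first \<open>N\<close> indices makes every remaining one suitable
      and keeps the sequence strictly increasing.\<close>
    have "strict_mono (\<lambda>k. n (k + N))" using n(1) by (simp add: strict_mono_def)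
    moreover have "cosine_adjoint \<alpha> w (n (k + N)) ` U \<inter> V \<noteq> {}" for k using N[of "k + N"] by auto
    ultimately show "\<exists>n :: nat \<Rightarrow> nat. strict_mono n \<and> (\<forall>k. n k \<ge> 1) \<and> (\<forall>k. cosine_adjoint \<alpha> w (n k) ` U \<inter> V \<noteq> {})"
      using n(2) by (intro exI[of _ "\<lambda>k. n (k + N)"]) auto
  qed
qed

end
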